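(* Let $(\Delta_{m-1},C)$ be a spectral duality structure with $n_{\mathrm{pair}}$ orbits and $n_0$ neutral sites. Let $d=n_{\mathrm{pair}}+n_0$ and let $\mathsf m:\Sigma^\circ\to\Delta_{d-1}^\circ$ assign to each $\pi$ its orbit masses $\mathsf m_O(\pi)=\sum_{z\in O}\pi_z$ (one for each orbit $O$), together with the neutral weights $\pi_{z_0}$ (one for each neutral site $z_0$). Then $\mathsf m$ is an isometry from $\Sigma^\circ$, with the Riemannian metric induced by the Fisher–Rao metric $g^{\mathrm{FR}}$ of $\Delta_{m-1}^\circ$, onto the Fisher–Rao simplex $(\Delta_{d-1}^\circ,g^{\mathrm{FR}})$. In particular $\Sigma^\circ$ carries no intrinsic geometry of its own: it is, canonically, the Fisher–Rao geometry of the coarse-grained model whose sites are the orbits of $\sigma$ (each neutral site counting as one site), and every tensorial computation on $\Sigma^\circ$ reduces, through the square-root map $\Phi$, to computations in a Euclidean subspace. Consequently, every intrinsic geometric invariant of the separatrix (curvature, connection, geodesics, volume) is inherited canonically from the Fisher–Rao simplex $(\Delta_{d-1}^\circ,g^{\mathrm{FR}})$ of the coarse-grained model.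
   Context: Let $m\ge2$ and let $Z=\{z_1,\dots,z_m\}$ be a set of $m$ distinct sites; coordinates of $\mathbb R^m$ are indexed by $Z$. For $n\ge1$, $\Delta_{n-1}=\{\pi\in\mathbb R^n:\pi_i\ge0,\ \sum_i\pi_i=1\}$, with relative interior $\Delta_{n-1}^\circ$ (all $\pi_i>0$), on which the Fisher–Rao metric is $g^{\mathrm{FR}}_\pi(h,k)=\sum_i h_ik_i/\pi_i$ for $h,k$ with coordinate sum $0$. The map $\Phi(\pi)=2\sqrt\pi$ (componentwise) is an isometry of $(\Delta_{m-1}^\circ,g^{\mathrm{FR}})$ onto the open positive octant of the round sphere of radius $2$ in $\mathbb R^m$. A spectral duality structure is a pair $(\Delta_{m-1},C)$, with $C:\Delta_{m-1}\times(0,1)\to\mathbb R$ smooth, admitting a spectral representation, i.e. data such that: (S1) for each $\gamma\in(0,1)$, $\pi\mapsto C(\pi,\gamma)$ is $\mathcal C^1$ on $\Delta^\circ_{m-1}$ and extends continuously to the boundary; (S2) $C(\pi,\gamma)=\sum_z\pi_zu(z;\gamma)/\sum_z\pi_zs(z;\gamma)$ with denominator strictly positive on $\Delta_{m-1}\times(0,1)$, where $u(z;\gamma)=\sum_{\nu=1}^Nf_\nu(\gamma)A_\nu(z)$, $s(z;\gamma)=\sum_{\nu=1}^Nf_\nu(\gamma)(A_\nu(z)+B_\nu(z))$, the $f_\nu$ are real-analytic and linearly independent on $(0,1)$, and the matrix $(A_\nu(z_i))\in\mathbb R^{N\times m}$ has full column rank $m\le N$; (S3) there are an involution $\sigma$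 of $Z$ with at least one non-trivial pair, and weights $\kappa(z)>0$ independent of $\nu$, with $B_\nu(z)=\kappa(z)A_\nu(\sigma(z))$ for all $\nu,z$; (S4) there is $K>0$ with $\kappa(z)\kappa(\sigma(z))=K$ for all $z$. An orbit is a pair $O=\{z,\sigma(z)\}$ with $\sigma(z)\neq z$; a neutral site is a fixed point of $\sigma$; so $m=2n_{\mathrm{pair}}+n_0$. The separatrix is $\Sigma=\{\pi\in\Delta_{m-1}: C(\pi,\gamma)\text{ is constant in }\gamma\in(0,1)\}$, and $\Sigma^\circ=\Sigma\cap\Delta^\circ_{m-1}$. The Euclidean subspace referred to is $L=\{x\in\mathbb R^m:\kappa(z)^{1/4}x_z=\kappa(\sigma(z))^{1/4}x_{\sigma(z)}\text{ for every orbit}\}$, for which $\Phi(\Sigma^\circ)$ is the intersection of $L$ with the open positive octant of the sphere of radius $2$. *)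

theory Defs
  imports "HOL-Analysis.Analysis"
begin

section \<open>Differentiable maps on subsets of Euclidean spaces\<close>

text \<open>On an open set, \<open>f\<close> is \<open>C\<^sup>k\<^sup>+\<^sup>1\<close> iff it is differentiable and all its
  directional derivatives are \<open>C\<^sup>k\<close> (in finite dimension).\<close>

primrec Ck_open :: "nat \<Rightarrow> 'a::euclidean_space set \<Rightarrow> ('a \<Rightarrow> 'b::real_normed_vector) \<Rightarrow> bool" where
  "Ck_open 0 U f \<longleftrightarrow> continuous_on U f"
| "Ck_open (Suc k) U f \<longleftrightarrow>
     (\<exists>f'. (\<forall>x\<in>U. (f has_derivative f' x) (at x)) \<and> (\<forall>v. Ck_open k U (\<lambda>x. f' x v)))"

text \<open>On an arbitrary subset \<open>S\<close> (a closed simplex, or an embedded submanifold) a map is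
  \<open>C\<^sup>1\<close>, respectively smooth, if near every point of \<open>S\<close> it is the restriction of
  such a map on an open subset of the ambient space.\<close>

definition C1_on :: "'a::euclidean_space set \<Rightarrow> ('a \<Rightarrow> 'b::real_normed_vector) \<Rightarrow> bool" where
  "C1_on S f \<longleftrightarrow>
     (\<forall>x\<in>S. \<exists>U g. open U \<and> x \<in> U \<and> Ck_open 1 U g \<and> (\<forall>y\<in>S \<inter> U. g y = f y))"

definition smooth_on :: "'a::euclidean_space set \<Rightarrow> ('a \<Rightarrow> 'b::real_normed_vector) \<Rightarrow> bool" where
  "smooth_on S f \<longleftrightarrow>
     (\<forall>x\<in>S. \<exists>U g. open U \<and> x \<in> U \<and> (\<forall>k. Ck_open k U g) \<and> (\<forall>y\<in>S \<inter> U. g y = f y))"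

definition diffeomorphism ::
  "'a::euclidean_space set \<Rightarrow> 'b::euclidean_space set \<Rightarrow> ('a \<Rightarrow> 'b) \<Rightarrow> bool" where
  "diffeomorphism S T F \<longleftrightarrow> bij_betw F S T \<and> smooth_on S F \<and> smooth_on T (inv_into S F)"

definition real_analytic_on :: "real set \<Rightarrow> (real \<Rightarrow> real) \<Rightarrow> bool" where
  "real_analytic_on S f \<longleftrightarrow>
     (\<forall>x\<in>S. \<exists>r>0. \<exists>a. \<forall>y. \<bar>y - x\<bar> < r \<longrightarrow> (\<lambda>n. a n * (y - x) ^ n) sums f y)"


section \<open>Embedded Riemannian manifolds\<close>

text \<open>Tangent vectors are the velocities of smooth curves in \<open>S\<close>.\<close>

definition tangent_space :: "'a::euclidean_space set \<Rightarrow> 'a \<Rightarrow> 'a set" where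
  "tangent_space S p =
     {v. \<exists>c \<epsilon>. 0 < \<epsilon> \<and> smooth_on {-\<epsilon><..<\<epsilon>} c \<and> c ` {-\<epsilon><..<\<epsilon>} \<subseteq> S \<and> c 0 = p \<and>
              (c has_vector_derivative v) (at (0::real))}"

text \<open>A derivative of a map \<open>F\<close> at \<open>p\<close> within \<open>S\<close> is unique on tangent vectors, so
  \<open>frechet_derivative F (at p within S) v\<close> is the differential \<open>dF\<^sub>p v\<close> for
  \<open>v \<in> tangent_space S p\<close>; it is only ever applied to such \<open>v\<close>.

  A local parametrization of dimension \<open>k\<close> is a diffeomorphism from an open subset \<open>W\<close> of a
  \<open>k\<close>-dimensional linear space onto an open subset of \<open>S\<close>. As \<open>k\<close> is a term, that linear space
  is the span of \<open>k\<close> independent vectors \<open>b 0, \<dots>, b (k - 1)\<close> of the ambient space.\<close>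

definition local_parametrization ::
  "nat \<Rightarrow> 'a::euclidean_space set \<Rightarrow> (nat \<Rightarrow> 'a) \<Rightarrow> 'a set \<Rightarrow> ('a \<Rightarrow> 'a) \<Rightarrow> bool" where
  "local_parametrization k S b W \<psi> \<longleftrightarrow>
     inj_on b {..<k} \<and> independent (b ` {..<k}) \<and>
     openin (top_of_set (span (b ` {..<k}))) W \<and>
     openin (top_of_set S) (\<psi> ` W) \<and> diffeomorphism W (\<psi> ` W) \<psi>"

definition embedded_submanifold :: "nat \<Rightarrow> 'a::euclidean_space set \<Rightarrow> bool" where
  "embedded_submanifold k S \<longleftrightarrow>
     (\<forall>p\<in>S. \<exists>b W \<psi>. local_parametrization k S b W \<psi> \<and> p \<in> \<psi> ` W)"

definition smooth_vector_field :: "'a::euclidean_space set \<Rightarrow> ('a \<Rightarrow> 'a) \<Rightarrow> bool" where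
  "smooth_vector_field S X \<longleftrightarrow> smooth_on S X \<and> (\<forall>p\<in>S. X p \<in> tangent_space S p)"

type_synonym 'a metric_tensor = "'a \<Rightarrow> 'a \<Rightarrow> 'a \<Rightarrow> real"

definition riemannian_metric :: "'a::euclidean_space set \<Rightarrow> 'a metric_tensor \<Rightarrow> bool" where
  "riemannian_metric S g \<longleftrightarrow>
     (\<forall>p\<in>S. \<forall>u\<in>tangent_space S p. \<forall>v\<in>tangent_space S p.
        g p u v = g p v u \<and>
        (\<forall>w\<in>tangent_space S p. \<forall>a. g p (a *\<^sub>R u + v) w = a * g p u w + g p v w) \<and>
        (u \<noteq> 0 \<longrightarrow> 0 < g p u u)) \<and>
     (\<forall>X Y. smooth_vector_field S X \<longrightarrow> smooth_vector_field S Y \<longrightarrow>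
        smooth_on S (\<lambda>p. g p (X p) (Y p)))"

definition riemannian_manifold ::
  "nat \<Rightarrow> 'a::euclidean_space set \<Rightarrow> 'a metric_tensor \<Rightarrow> bool" where
  "riemannian_manifold k S g \<longleftrightarrow> embedded_submanifold k S \<and> riemannian_metric S g"

text \<open>Only the values of a metric tensor on tangent vectors of \<open>S\<close> matter below, so a metric of
  the ambient manifold, used on a submanifold \<open>S\<close>, is the induced metric of \<open>S\<close>.\<close>

definition riemannian_isometry ::
  "'a::euclidean_space set \<Rightarrow> 'a metric_tensor \<Rightarrow>
   'b::euclidean_space set \<Rightarrow> 'b metric_tensor \<Rightarrow> ('a \<Rightarrow> 'b) \<Rightarrow> bool" where
  "riemannian_isometry S g T h F \<longleftrightarrow>
     diffeomorphism S T F \<and>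
     (\<forall>p\<in>S. \<forall>v\<in>tangent_space S p. \<forall>w\<in>tangent_space S p.
        h (F p) (frechet_derivative F (at p within S) v) (frechet_derivative F (at p within S) w)
        = g p v w)"

definition pushforward ::
  "'a::euclidean_space set \<Rightarrow> ('a \<Rightarrow> 'b::euclidean_space) \<Rightarrow> ('a \<Rightarrow> 'a) \<Rightarrow> 'b \<Rightarrow> 'b" where
  "pushforward S F X q =
     frechet_derivative F (at (inv_into S F q) within S) (X (inv_into S F q))"


subsection \<open>Connection, curvature, geodesics, volume\<close>

definition lie_bracket ::
  "'a::euclidean_space set \<Rightarrow> ('a \<Rightarrow> 'a) \<Rightarrow> ('a \<Rightarrow> 'a) \<Rightarrow> 'a \<Rightarrow> 'a" where
  "lie_bracket S X Y p =
     frechet_derivative Y (at p within S) (X p) - frechet_derivative X (at p within S) (Y p)"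

text \<open>The Levi-Civita connection \<open>\<nabla>\<^sub>X Y\<close>, given by the Koszul formula.\<close>

definition levi_civita ::
  "'a::euclidean_space set \<Rightarrow> 'a metric_tensor \<Rightarrow> ('a \<Rightarrow> 'a) \<Rightarrow> ('a \<Rightarrow> 'a) \<Rightarrow> 'a \<Rightarrow> 'a" where
  "levi_civita S g X Y p =
     (THE w. w \<in> tangent_space S p \<and>
        (\<forall>Z. smooth_vector_field S Z \<longrightarrow>
           2 * g p w (Z p) =
             frechet_derivative (\<lambda>q. g q (Y q) (Z q)) (at p within S) (X p)
           + frechet_derivative (\<lambda>q. g q (Z q) (X q)) (at p within S) (Y p)
           - frechet_derivative (\<lambda>q. g q (X q) (Y q)) (at p within S) (Z p)
           + g p (lie_bracket S X Y p) (Z p)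
           - g p (lie_bracket S X Z p) (Y p)
           - g p (lie_bracket S Y Z p) (X p)))"

definition riemann_curvature ::
  "'a::euclidean_space set \<Rightarrow> 'a metric_tensor \<Rightarrow>
   ('a \<Rightarrow> 'a) \<Rightarrow> ('a \<Rightarrow> 'a) \<Rightarrow> ('a \<Rightarrow> 'a) \<Rightarrow> 'a \<Rightarrow> 'a" where
  "riemann_curvature S g X Y Z p =
     levi_civita S g X (levi_civita S g Y Z) p
   - levi_civita S g Y (levi_civita S g X Z) p
   - levi_civita S g (lie_bracket S X Y) Z p"

text \<open>Covariant derivative at time \<open>t\<close> of a field \<open>V\<close> along a curve \<open>c\<close>: if
  \<open>V = \<Sum>\<^sub>j a\<^sub>j (E\<^sub>j \<circ> c)\<close> near \<open>t\<close>, with vector fields \<open>E\<^sub>j\<close> on \<open>S\<close>, then it is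
  \<open>\<Sum>\<^sub>j (a\<^sub>j' E\<^sub>j + a\<^sub>j \<nabla>\<^bsub>c'\<^esub> E\<^sub>j)\<close>. As \<open>\<nabla>\<close> is tensorial in its first
  argument, \<open>c'(t)\<close> may be extended to any vector field \<open>X\<close>.\<close>

definition has_covariant_derivative ::
  "'a::euclidean_space set \<Rightarrow> 'a metric_tensor \<Rightarrow> (real \<Rightarrow> 'a) \<Rightarrow> (real \<Rightarrow> 'a) \<Rightarrow> real \<Rightarrow> 'a \<Rightarrow> bool"
where
  "has_covariant_derivative S g c V t w \<longleftrightarrow>
     (\<exists>(n::nat) E a a' X.
        (\<forall>j<n. smooth_vector_field S (E j)) \<and>
        (\<forall>j<n. (a j has_real_derivative a' j) (at t)) \<and>
        eventually (\<lambda>s. V s = (\<Sum>j<n. a j s *\<^sub>R E j (c s))) (nhds t) \<and>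
        smooth_vector_field S X \<and> X (c t) = vector_derivative c (at t) \<and>
        w = (\<Sum>j<n. a' j *\<^sub>R E j (c t) + a j t *\<^sub>R levi_civita S g X (E j) (c t)))"

definition geodesic ::
  "'a::euclidean_space set \<Rightarrow> 'a metric_tensor \<Rightarrow> real set \<Rightarrow> (real \<Rightarrow> 'a) \<Rightarrow> bool" where
  "geodesic S g I c \<longleftrightarrow>
     open I \<and> is_interval I \<and> smooth_on I c \<and> c ` I \<subseteq> S \<and>
     (\<forall>t\<in>I. has_covariant_derivative S g c (\<lambda>s. vector_derivative c (at s)) t 0)"

text \<open>Volume of the part of \<open>B\<close> covered by the local parametrization \<open>\<psi>\<close>: the integral of
  \<open>sqrt (det (g (\<partial>\<^sub>i \<psi>, \<partial>\<^sub>j \<psi>)))\<close> in the coordinates with respect to \<open>b\<close>.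
  The determinant is given by the Leibniz formula since its size \<open>k\<close> is a term.\<close>

definition gram_det :: "nat \<Rightarrow> (nat \<Rightarrow> nat \<Rightarrow> real) \<Rightarrow> real" where
  "gram_det k G = (\<Sum>p | p permutes {..<k}. of_int (sign p) * (\<Prod>i<k. G i (p i)))"

definition parametrized_volume ::
  "nat \<Rightarrow> 'a::euclidean_space metric_tensor \<Rightarrow> (nat \<Rightarrow> 'a) \<Rightarrow> 'a set \<Rightarrow> ('a \<Rightarrow> 'a) \<Rightarrow> 'a set \<Rightarrow> ennreal"
where
  "parametrized_volume k g b W \<psi> B =
     (\<integral>\<^sup>+ x. (let y = (\<Sum>i<k. x i *\<^sub>R b i) in
              if y \<in> W \<and> \<psi> y \<in> B
              then ennreal (sqrt (gram_det k (\<lambda>i j.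
                     g (\<psi> y) (frechet_derivative \<psi> (at y within W) (b i))
                             (frechet_derivative \<psi> (at y within W) (b j)))))
              else 0)
        \<partial>(\<Pi>\<^sub>M i\<in>{..<k}. lborel))"

text \<open>Riemannian volume of a Borel subset \<open>A\<close> of a \<open>k\<close>-dimensional manifold \<open>S\<close>: the supremum of
  the total volume of finitely many disjoint Borel pieces of \<open>A\<close>, each in the range of a local
  parametrization. The supremum allows for manifolds without a finite atlas.\<close>

definition riemannian_volume ::
  "nat \<Rightarrow> 'a::euclidean_space set \<Rightarrow> 'a metric_tensor \<Rightarrow> 'a set \<Rightarrow> ennreal" where
  "riemannian_volume k S g A =
     Sup {(\<Sum>i<n. parametrized_volume k g (b i) (W i) (\<psi> i) (B i)) | (n::nat) b W \<psi> B.
            (\<forall>i<n. local_parametrization k S (b i) (W i) (\<psi> i) \<and>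
                   B i \<in> sets borel \<and> B i \<subseteq> A \<inter> \<psi> i ` W i) \<and>
            disjoint_family_on B {..<n}}"


subsection \<open>Transport of the intrinsic geometry by a map\<close>

definition preserves_connection ::
  "'a::euclidean_space set \<Rightarrow> 'a metric_tensor \<Rightarrow>
   'b::euclidean_space set \<Rightarrow> 'b metric_tensor \<Rightarrow> ('a \<Rightarrow> 'b) \<Rightarrow> bool" where
  "preserves_connection S g T h F \<longleftrightarrow>
     (\<forall>X Y. smooth_vector_field S X \<longrightarrow> smooth_vector_field S Y \<longrightarrow>
        (\<forall>q\<in>T. pushforward S F (levi_civita S g X Y) q =
                levi_civita T h (pushforward S F X) (pushforward S F Y) q))"

definition preserves_curvature ::
  "'a::euclidean_space set \<Rightarrow> 'a metric_tensor \<Rightarrow>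
   'b::euclidean_space set \<Rightarrow> 'b metric_tensor \<Rightarrow> ('a \<Rightarrow> 'b) \<Rightarrow> bool" where
  "preserves_curvature S g T h F \<longleftrightarrow>
     (\<forall>X Y Z. smooth_vector_field S X \<longrightarrow> smooth_vector_field S Y \<longrightarrow> smooth_vector_field S Z \<longrightarrow>
        (\<forall>q\<in>T. pushforward S F (riemann_curvature S g X Y Z) q =
                riemann_curvature T h
                  (pushforward S F X) (pushforward S F Y) (pushforward S F Z) q))"

definition preserves_geodesics ::
  "'a::euclidean_space set \<Rightarrow> 'a metric_tensor \<Rightarrow>
   'b::euclidean_space set \<Rightarrow> 'b metric_tensor \<Rightarrow> ('a \<Rightarrow> 'b) \<Rightarrow> bool" where
  "preserves_geodesics S g T h F \<longleftrightarrow>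
     (\<forall>I c. c ` I \<subseteq> S \<longrightarrow> (geodesic S g I c \<longleftrightarrow> geodesic T h I (F \<circ> c)))"

definition preserves_volume ::
  "nat \<Rightarrow> 'a::euclidean_space set \<Rightarrow> 'a metric_tensor \<Rightarrow>
   'b::euclidean_space set \<Rightarrow> 'b metric_tensor \<Rightarrow> ('a \<Rightarrow> 'b) \<Rightarrow> bool" where
  "preserves_volume k S g T h F \<longleftrightarrow>
     (\<forall>A. A \<subseteq> S \<longrightarrow> A \<in> sets borel \<longrightarrow>
        riemannian_volume k S g A = riemannian_volume k T h (F ` A))"

text \<open>An intrinsic invariant takes the same value on isometric manifolds. HOL cannot
  quantify over polymorphic functions, so its instances \<open>\<iota>\<close> and \<open>\<iota>'\<close> for submanifolds of the
  two ambient spaces are separate arguments.\<close>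

definition intrinsic_invariant ::
  "('a::euclidean_space set \<Rightarrow> 'a metric_tensor \<Rightarrow> 'v) \<Rightarrow>
   ('b::euclidean_space set \<Rightarrow> 'b metric_tensor \<Rightarrow> 'v) \<Rightarrow> bool" where
  "intrinsic_invariant \<iota> \<iota>' \<longleftrightarrow>
     (\<forall>k S g T h F. riemannian_manifold k S g \<longrightarrow> riemannian_manifold k T h \<longrightarrow>
        riemannian_isometry S g T h F \<longrightarrow> \<iota> S g = \<iota>' T h)"


section \<open>Simplices with the Fisher-Rao metric\<close>

text \<open>The simplex of probability vectors on a set \<open>I\<close> of coordinates, in the coordinate
  subspace \<open>{x. \<forall>i. i \<notin> I \<longrightarrow> x $ i = 0}\<close> of dimension \<open>card I\<close>.\<close>

definition prob_simplex :: "'i set \<Rightarrow> (real ^ 'i::finite) set" where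
  "prob_simplex I =
     {\<pi>. (\<forall>i\<in>I. 0 \<le> \<pi> $ i) \<and> (\<forall>i. i \<notin> I \<longrightarrow> \<pi> $ i = 0) \<and> (\<Sum>i\<in>I. \<pi> $ i) = 1}"

definition open_prob_simplex :: "'i set \<Rightarrow> (real ^ 'i::finite) set" where
  "open_prob_simplex I = {\<pi> \<in> prob_simplex I. \<forall>i\<in>I. 0 < \<pi> $ i}"

definition fisher_rao :: "'i set \<Rightarrow> (real ^ 'i::finite) metric_tensor" where
  "fisher_rao I \<pi> h k = (\<Sum>i\<in>I. h $ i * k $ i / \<pi> $ i)"

definition sqrt_map :: "real ^ 'i::finite \<Rightarrow> real ^ 'i" where
  "sqrt_map \<pi> = (\<chi> i. 2 * sqrt (\<pi> $ i))"


section \<open>Spectral duality structures\<close>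

definition spectral_numerator ::
  "('n::finite \<Rightarrow> real \<Rightarrow> real) \<Rightarrow> real ^ 'z ^ 'n \<Rightarrow> 'z::finite \<Rightarrow> real \<Rightarrow> real" where
  "spectral_numerator f A z \<gamma> = (\<Sum>\<nu>\<in>UNIV. f \<nu> \<gamma> * A $ \<nu> $ z)"

definition spectral_denominator ::
  "('n::finite \<Rightarrow> real \<Rightarrow> real) \<Rightarrow> real ^ 'z ^ 'n \<Rightarrow> real ^ 'z ^ 'n \<Rightarrow> 'z::finite \<Rightarrow> real \<Rightarrow> real" where
  "spectral_denominator f A B z \<gamma> = (\<Sum>\<nu>\<in>UNIV. f \<nu> \<gamma> * (A $ \<nu> $ z + B $ \<nu> $ z))"

text \<open>The structure \<open>(\<Delta>, C)\<close> together with its spectral representation. The sites are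
  the elements of \<open>'z\<close> and the spectral indices those of \<open>'n\<close>, so that \<open>m = CARD('z)\<close> and
  \<open>N = CARD('n)\<close>. Of \<open>C\<close>, only the values on \<open>\<Delta> \<times> (0,1)\<close> matter.\<close>

definition spectral_duality_structure ::
  "(real ^ 'z::finite \<Rightarrow> real \<Rightarrow> real) \<Rightarrow> ('n::finite \<Rightarrow> real \<Rightarrow> real) \<Rightarrow>
   real ^ 'z ^ 'n \<Rightarrow> real ^ 'z ^ 'n \<Rightarrow> ('z \<Rightarrow> 'z) \<Rightarrow> ('z \<Rightarrow> real) \<Rightarrow> bool" where
  "spectral_duality_structure C f A B \<sigma> \<kappa> \<longleftrightarrow>
     smooth_on (prob_simplex UNIV \<times> {0<..<1}) (\<lambda>(\<pi>, \<gamma>). C \<pi> \<gamma>) \<and>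
     (\<forall>\<gamma>\<in>{0<..<1}. C1_on (open_prob_simplex UNIV) (\<lambda>\<pi>. C \<pi> \<gamma>) \<and>
                   continuous_on (prob_simplex UNIV) (\<lambda>\<pi>. C \<pi> \<gamma>)) \<and>
     (\<forall>\<pi>\<in>prob_simplex UNIV. \<forall>\<gamma>\<in>{0<..<1}.
        0 < (\<Sum>z\<in>UNIV. \<pi> $ z * spectral_denominator f A B z \<gamma>) \<and>
        C \<pi> \<gamma> = (\<Sum>z\<in>UNIV. \<pi> $ z * spectral_numerator f A z \<gamma>) /
                (\<Sum>z\<in>UNIV. \<pi> $ z * spectral_denominator f A B z \<gamma>)) \<and>
     (\<forall>\<nu>. real_analytic_on {0<..<1} (f \<nu>)) \<and>
     (\<forall>a. (\<forall>\<gamma>\<in>{0<..<1}. (\<Sum>\<nu>\<in>UNIV. a \<nu> * f \<nu> \<gamma>) = 0) \<longrightarrow> (\<forall>\<nu>. a \<nu> = 0)) \<and>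
     CARD('z) \<le> CARD('n) \<and> rank A = CARD('z) \<and>
     (\<forall>z. \<sigma> (\<sigma> z) = z) \<and> (\<exists>z. \<sigma> z \<noteq> z) \<and>
     (\<forall>z. 0 < \<kappa> z) \<and> (\<forall>\<nu> z. B $ \<nu> $ z = \<kappa> z * A $ \<nu> $ \<sigma> z) \<and>
     (\<exists>K>0. \<forall>z. \<kappa> z * \<kappa> (\<sigma> z) = K)"

definition orbits :: "('z \<Rightarrow> 'z) \<Rightarrow> 'z set set" where
  "orbits \<sigma> = {{z, \<sigma> z} | z. \<sigma> z \<noteq> z}"

definition neutral_sites :: "('z \<Rightarrow> 'z) \<Rightarrow> 'z set" where
  "neutral_sites \<sigma> = {z. \<sigma> z = z}"

text \<open>A neutral site \<open>z\<close> is represented by \<open>{z}\<close> among the sites of the coarse-grained model, whose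
  simplex is \<open>prob_simplex (coarse_sites \<sigma>)\<close>.\<close>

definition coarse_sites :: "('z \<Rightarrow> 'z) \<Rightarrow> 'z set set" where
  "coarse_sites \<sigma> = orbits \<sigma> \<union> (\<lambda>z. {z}) ` neutral_sites \<sigma>"

definition coarse_mass :: "('z::finite \<Rightarrow> 'z) \<Rightarrow> real ^ 'z \<Rightarrow> real ^ 'z set" where
  "coarse_mass \<sigma> \<pi> = (\<chi> Q. if Q \<in> coarse_sites \<sigma> then \<Sum>z\<in>Q. \<pi> $ z else 0)"

definition separatrix :: "(real ^ 'z::finite \<Rightarrow> real \<Rightarrow> real) \<Rightarrow> (real ^ 'z) set" where
  "separatrix C = {\<pi> \<in> prob_simplex UNIV. (\<lambda>\<gamma>. C \<pi> \<gamma>) constant_on {0<..<1}}"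

definition separatrix_interior :: "(real ^ 'z::finite \<Rightarrow> real \<Rightarrow> real) \<Rightarrow> (real ^ 'z) set" where
  "separatrix_interior C = separatrix C \<inter> open_prob_simplex UNIV"

definition balance_subspace :: "('z::finite \<Rightarrow> 'z) \<Rightarrow> ('z \<Rightarrow> real) \<Rightarrow> (real ^ 'z) set" where
  "balance_subspace \<sigma> \<kappa> =
     {x. \<forall>z. \<sigma> z \<noteq> z \<longrightarrow> \<kappa> z powr (1/4) * x $ z = \<kappa> (\<sigma> z) powr (1/4) * x $ \<sigma> z}"

end

theory Submission
  imports Defs
begin

text \<open>
  Linear independence of the \<open>f\<^sub>\<nu>\<close> and the full rank of \<open>A\<close> turn constancy of \<open>C\<close> in \<open>\<gamma>\<close> into the
  detailed balance condition \<open>\<surd>\<kappa>(z) \<pi>\<^sub>z = \<surd>\<kappa>(\<sigma> z) \<pi>\<^bsub>\<sigma> z\<^esub>\<close>. A balanced vector is determined linearly by its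
  orbit masses, \<open>\<pi>\<^sub>z = w\<^sub>z m\<^sub>O\<close> with fixed shares \<open>w\<^sub>z\<close> summing to 1 on each orbit \<open>O\<close>, and
  \<open>(w h) (w k) / (w m) = w (h k / m)\<close>, so summing over orbits preserves the Fisher-Rao metric. Both
  manifolds are relatively open in affine subspaces, and on both the Levi-Civita connection is
  \<open>\<nabla>\<^sub>X Y = D\<^sub>X Y - (X Y / p - g(X, Y) p) / 2\<close>, an expression which the linear isometry respects;
  connection, curvature, geodesics and volume are therefore carried over.
\<close>

section \<open>Calculus of smooth maps\<close>

text \<open>Both manifolds have empty interior in their ambient spaces, so
  \<open>frechet_derivative\<close> within them is a choice among many linear maps, and the
  \<open>THE\<close> in \<open>levi_civita\<close> must be shown to denote something. Flatness
  rescues both: short segments in tangent directions stay in the set, which pins down derivatives on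
  tangent vectors, makes the tangent space the same at every point, and lets constant fields serve
  as test fields. The coarse-graining map is linear with a linear inverse, so derivatives of fields
  are transported without a second-order term, and each invariant can be compared through its own
  formula. The multiple of \<open>p\<close> in the connection is a normal correction: the metric
  pairs \<open>p\<close> to zero with every vector of coordinate sum 0, and the coefficient g(X, Y)
  brings the coordinate sum back to 0. Constancy of \<open>C\<close> makes \<open>p\<close>
  proportional to its reweighted reflection under \<open>\<sigma>\<close>. Eliminating the ratio
  between \<open>z\<close> and \<open>\<sigma> z\<close> produces the square roots of
  \<open>\<kappa>\<close>; conversely the common \<open>K\<close> gives all orbits the same
  ratio.\<close>

lemma Ck_open_subset: "Ck_open k U f \<Longrightarrow> U' \<subseteq> U \<Longrightarrow> Ck_open k U' f"
proof (induction k arbitrary: f)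
  case 0
  then show ?case by (auto intro: continuous_on_subset)
next
  case (Suc k)
  then obtain f' where "\<forall>x\<in>U. (f has_derivative f' x) (at x)" "\<forall>v. Ck_open k U (\<lambda>x. f' x v)"
    by auto
  with Suc.IH Suc.prems(2) show ?case
    unfolding Ck_open.simps by (intro exI[of _ f']) blast
qed

lemma Ck_open_SucD: "Ck_open (Suc k) U f \<Longrightarrow> Ck_open k U f"
proof (induction k arbitrary: f)
  case 0
  then show ?case
    by (auto intro!: continuous_at_imp_continuous_on intro: has_derivative_continuous)
next
  case (Suc k)
  then obtain f' where "\<forall>x\<in>U. (f has_derivative f' x) (at x)"
    "\<And>v. Ck_open (Suc k) U (\<lambda>x. f' x v)"
    unfolding Ck_open.simps(2)[of "Suc k"] by auto
  with Suc.IH show ?case by auto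
qed

lemma Ck_open_cong:
  assumes "open U" "\<And>x. x \<in> U \<Longrightarrow> f x = g x" "Ck_open k U f"
  shows "Ck_open k U g"
proof (cases k)
  case 0
  with assms show ?thesis by (simp cong: continuous_on_cong)
next
  case (Suc j)
  with assms(3) obtain f' where "\<forall>x\<in>U. (f has_derivative f' x) (at x)"
    "\<And>v. Ck_open j U (\<lambda>x. f' x v)" by auto
  with assms Suc show ?thesis
    by (auto intro!: exI[of _ f'] intro: has_derivative_transform_within_open)
qed

lemma Ck_open_const: "Ck_open k U (\<lambda>x. c)"
proof (induction k arbitrary: c)
  case (Suc k)
  then show ?case by (auto intro!: exI[of _ "\<lambda>x v. 0"])
qed simp

lemma Ck_open_add: "Ck_open k U f \<Longrightarrow> Ck_open k U g \<Longrightarrow> Ck_open k U (\<lambda>x. f x + g x)"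
proof (induction k arbitrary: f g)
  case 0
  then show ?case by (auto intro: continuous_on_add)
next
  case (Suc k)
  obtain f' where f: "\<forall>x\<in>U. (f has_derivative f' x) (at x)" "\<And>v. Ck_open k U (\<lambda>x. f' x v)"
    using Suc.prems by auto
  obtain g' where g: "\<forall>x\<in>U. (g has_derivative g' x) (at x)" "\<And>v. Ck_open k U (\<lambda>x. g' x v)"
    using Suc.prems by auto
  show ?case
    unfolding Ck_open.simps using f g Suc.IH has_derivative_add
    by (intro exI[of _ "\<lambda>x v. f' x v + g' x v"]) blast
qed

lemma Ck_open_sum:
  "(\<And>i. i \<in> A \<Longrightarrow> Ck_open k U (f i)) \<Longrightarrow> Ck_open k U (\<lambda>x. \<Sum>i\<in>A. f i x)"
  by (induction A rule: infinite_finite_induct) (auto intro: Ck_open_const Ck_open_add)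

lemma Ck_open_linear_compose:
  assumes "bounded_linear h"
  shows "Ck_open k U f \<Longrightarrow> Ck_open k U (\<lambda>x. h (f x))"
proof (induction k arbitrary: f)
  case 0
  then show ?case
    using bounded_linear.continuous_on[OF assms] by auto
next
  case (Suc k)
  then obtain f' where "\<forall>x\<in>U. (f has_derivative f' x) (at x)" "\<And>v. Ck_open k U (\<lambda>x. f' x v)"
    by auto
  with Suc.IH bounded_linear.has_derivative[OF assms] show ?case
    unfolding Ck_open.simps by (intro exI[of _ "\<lambda>x v. h (f' x v)"]) blast
qed

lemma Ck_open_ident: "Ck_open k U (\<lambda>x. x)"
proof (cases k)
  case (Suc j)
  then show ?thesis
    by (auto intro!: exI[of _ "\<lambda>x v. v"] has_derivative_ident Ck_open_const)
qed (auto intro: continuous_on_id)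

lemma Ck_open_bilinear:
  assumes "bounded_bilinear bl"
  shows "Ck_open k U f \<Longrightarrow> Ck_open k U g \<Longrightarrow> Ck_open k U (\<lambda>x. bl (f x) (g x))"
proof (induction k arbitrary: f g)
  case 0
  then show ?case
    using bounded_bilinear.continuous_on[OF assms] by auto
next
  case (Suc k)
  obtain f' where f: "\<forall>x\<in>U. (f has_derivative f' x) (at x)" "\<And>v. Ck_open k U (\<lambda>x. f' x v)"
    using Suc.prems by auto
  obtain g' where g: "\<forall>x\<in>U. (g has_derivative g' x) (at x)" "\<And>v. Ck_open k U (\<lambda>x. g' x v)"
    using Suc.prems by auto
  have fg: "Ck_open k U f" "Ck_open k U g"
    using Suc.prems Ck_open_SucD by blast+
  have "Ck_open k U (\<lambda>x. bl (f x) (g' x v) + bl (f' x v) (g x))" for v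
    by (intro Ck_open_add Suc.IH fg f(2) g(2))
  moreover have "((\<lambda>x. bl (f x) (g x)) has_derivative (\<lambda>v. bl (f x) (g' x v) + bl (f' x v) (g x))) (at x)"
    if "x \<in> U" for x
    using bounded_bilinear.FDERIV[OF assms] f(1) g(1) that by blast
  ultimately show ?case
    unfolding Ck_open.simps by (intro exI[of _ "\<lambda>x v. bl (f x) (g' x v) + bl (f' x v) (g x)"]) blast
qed

lemma Ck_open_compose:
  fixes f :: "'a::euclidean_space \<Rightarrow> 'b::euclidean_space" and g :: "'b \<Rightarrow> 'c::real_normed_vector"
  assumes "f ` U \<subseteq> V" "open U"
  shows "Ck_open k U f \<Longrightarrow> Ck_open k V g \<Longrightarrow> Ck_open k U (\<lambda>x. g (f x))"
proof (induction k arbitrary: g)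
  case 0
  then show ?case using continuous_on_compose2[of V g U f] assms by auto
next
  case (Suc k)
  obtain f' where f: "\<forall>x\<in>U. (f has_derivative f' x) (at x)" "\<And>v. Ck_open k U (\<lambda>x. f' x v)"
    using Suc.prems by auto
  obtain g' where g: "\<forall>x\<in>V. (g has_derivative g' x) (at x)" "\<And>v. Ck_open k V (\<lambda>x. g' x v)"
    using Suc.prems by auto
  have fk: "Ck_open k U f" using Suc.prems Ck_open_SucD by blast
  \<comment> \<open>\<open>Ck_open\<close> controls \<open>g'\<close> in fixed directions only, but
    the chain rule evaluates it in the direction \<open>f' x v\<close>, which moves with
    \<open>x\<close>. The basis expansion splits this into moving scalars times fixed
    directions.\<close>
  have expand: "g' (f x) w = (\<Sum>b\<in>Basis. (w \<bullet> b) *\<^sub>R g' (f x) b)" if "x \<in> U" for x w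
  proof -
    have "linear (g' (f x))"
      using g(1) that assms(1) has_derivative_linear by blast
    then have "g' (f x) (\<Sum>b\<in>Basis. (w \<bullet> b) *\<^sub>R b) = (\<Sum>b\<in>Basis. (w \<bullet> b) *\<^sub>R g' (f x) b)"
      by (simp add: linear_sum linear_cmul)
    then show ?thesis by (simp add: euclidean_representation)
  qed
  have "Ck_open k U (\<lambda>x. \<Sum>b\<in>Basis. (f' x v \<bullet> b) *\<^sub>R g' (f x) b)" for v
    by (intro Ck_open_sum Ck_open_bilinear[OF bounded_bilinear_scaleR] f(2) Suc.IH fk g(2)
        Ck_open_linear_compose[OF bounded_linear_inner_left])
  then have "Ck_open k U (\<lambda>x. g' (f x) (f' x v))" for v
    by (rule Ck_open_cong[OF \<open>open U\<close>, rotated]) (simp add: expand[symmetric])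
  moreover have "((\<lambda>x. g (f x)) has_derivative (\<lambda>v. g' (f x) (f' x v))) (at x)" if "x \<in> U" for x
    using f(1) g(1) that assms(1) by (intro has_derivative_compose[of f "f' x" x UNIV g]) auto
  ultimately show ?case
    unfolding Ck_open.simps by (intro exI[of _ "\<lambda>x v. g' (f x) (f' x v)"]) blast
qed

lemma Ck_open_inverse: "Ck_open k (- {0}) (inverse :: real \<Rightarrow> real)"
proof (induction k)
  case 0
  then show ?case by (auto intro!: continuous_intros)
next
  case (Suc k)
  have "Ck_open k (- {0}) (\<lambda>x::real. - (inverse x * v * inverse x))" for v
    by (intro Ck_open_linear_compose[OF bounded_linear_minus[OF bounded_linear_ident]]
        Ck_open_bilinear[OF bounded_bilinear_mult] Suc.IH Ck_open_const)
  moreover have "(inverse has_derivative (\<lambda>v. - (inverse x * v * inverse x))) (at x)"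
    if "x \<in> - {0}" for x :: real
    using has_derivative_inverse'[of x UNIV] that by simp
  ultimately show ?case
    unfolding Ck_open.simps by (intro exI[of _ "\<lambda>x v. - (inverse x * v * inverse x)"]) blast
qed

lemma Ck_open_sqrt: "Ck_open k {0<..} sqrt"
proof (induction k)
  case 0
  then show ?case by (auto intro!: continuous_intros)
next
  case (Suc k)
  \<comment> \<open>The derivative 1 / (2 sqrt x) is rewritten as sqrt x / (2 x), so that it
    contains \<open>sqrt\<close> itself and the induction hypothesis applies.\<close>
  have "Ck_open k {0<..} (\<lambda>x::real. sqrt x * inverse x * (v / 2))" for v
    by (intro Ck_open_bilinear[OF bounded_bilinear_mult] Suc.IH Ck_open_const
        Ck_open_subset[OF Ck_open_inverse]) auto
  moreover have "(sqrt has_derivative (\<lambda>v. sqrt x * inverse x * (v / 2))) (at x)"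
    if "x \<in> {0<..}" for x
  proof -
    have *: "inverse (sqrt x) / 2 = sqrt x * inverse x / 2"
      using that real_sqrt_mult_self[of x] by (simp add: field_simps)
    have "(sqrt has_real_derivative (sqrt x * inverse x / 2)) (at x)"
      using DERIV_real_sqrt[of x] that unfolding * by auto
    then show ?thesis
      unfolding has_field_derivative_def by (rule has_derivative_eq_rhs) (auto simp: fun_eq_iff)
  qed
  ultimately show ?case
    unfolding Ck_open.simps by (intro exI[of _ "\<lambda>x v. sqrt x * inverse x * (v / 2)"]) blast
qed

section \<open>Smooth maps on arbitrary subsets\<close>

lemma smooth_onI:
  assumes "\<And>x. x \<in> S \<Longrightarrow> \<exists>U g. open U \<and> x \<in> U \<and> (\<forall>k. Ck_open k U g) \<and> (\<forall>y\<in>S \<inter> U. g y = f y)"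
  shows "smooth_on S f"
  using assms unfolding smooth_on_def by blast

lemma smooth_onE:
  assumes "smooth_on S f" "x \<in> S"
  obtains U g where "open U" "x \<in> U" "\<And>k. Ck_open k U g" "\<And>y. y \<in> S \<Longrightarrow> y \<in> U \<Longrightarrow> g y = f y"
proof -
  have "\<exists>U g. open U \<and> x \<in> U \<and> (\<forall>k. Ck_open k U g) \<and> (\<forall>y\<in>S \<inter> U. g y = f y)"
    using assms(1) unfolding smooth_on_def using assms(2) by (rule bspec)
  then show ?thesis using that by auto
qed

lemma smooth_on_cong:
  assumes "\<And>x. x \<in> S \<Longrightarrow> f x = g x"
  shows "smooth_on S f \<longleftrightarrow> smooth_on S g"
proof -
  have "(\<forall>y\<in>S \<inter> U. h y = f y) \<longleftrightarrow> (\<forall>y\<in>S \<inter> U. h y = g y)" for U h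
    using assms by auto
  then show ?thesis unfolding smooth_on_def by simp
qed

lemma smooth_on_Ck:
  assumes "open U" "\<And>k. Ck_open k U f" "S \<subseteq> U"
  shows "smooth_on S f"
  using assms unfolding smooth_on_def by blast

lemma smooth_on_const: "smooth_on S (\<lambda>x. c)"
  by (rule smooth_on_Ck[of UNIV]) (auto intro: Ck_open_const)

lemma smooth_on_ident: "smooth_on S (\<lambda>x. x)"
  by (rule smooth_on_Ck[of UNIV]) (auto intro: Ck_open_ident)

lemma smooth_on_bilinear:
  assumes "bounded_bilinear bl" "smooth_on S f" "smooth_on S g"
  shows "smooth_on S (\<lambda>x. bl (f x) (g x))"
proof (rule smooth_onI)
  fix x assume "x \<in> S"
  obtain U F where F: "open U" "x \<in> U" "\<And>k. Ck_open k U F" "\<And>y. y \<in> S \<Longrightarrow> y \<in> U \<Longrightarrow> F y = f y"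
    using smooth_onE[OF assms(2) \<open>x \<in> S\<close>] by blast
  obtain V G where G: "open V" "x \<in> V" "\<And>k. Ck_open k V G" "\<And>y. y \<in> S \<Longrightarrow> y \<in> V \<Longrightarrow> G y = g y"
    using smooth_onE[OF assms(3) \<open>x \<in> S\<close>] by blast
  show "\<exists>U h. open U \<and> x \<in> U \<and> (\<forall>k. Ck_open k U h) \<and> (\<forall>y\<in>S \<inter> U. h y = bl (f y) (g y))"
    using F G
    by (intro exI[of _ "U \<inter> V"] exI[of _ "\<lambda>x. bl (F x) (G x)"])
       (auto intro!: Ck_open_bilinear[OF assms(1)] intro: Ck_open_subset)
qed

lemma smooth_on_add:
  assumes "smooth_on S f" "smooth_on S g"
  shows "smooth_on S (\<lambda>x. f x + g x)"
proof (rule smooth_onI)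
  fix x assume "x \<in> S"
  obtain U F where F: "open U" "x \<in> U" "\<And>k. Ck_open k U F" "\<And>y. y \<in> S \<Longrightarrow> y \<in> U \<Longrightarrow> F y = f y"
    using smooth_onE[OF assms(1) \<open>x \<in> S\<close>] by blast
  obtain V G where G: "open V" "x \<in> V" "\<And>k. Ck_open k V G" "\<And>y. y \<in> S \<Longrightarrow> y \<in> V \<Longrightarrow> G y = g y"
    using smooth_onE[OF assms(2) \<open>x \<in> S\<close>] by blast
  show "\<exists>U h. open U \<and> x \<in> U \<and> (\<forall>k. Ck_open k U h) \<and> (\<forall>y\<in>S \<inter> U. h y = f y + g y)"
    using F G
    by (intro exI[of _ "U \<inter> V"] exI[of _ "\<lambda>x. F x + G x"])
       (auto intro!: Ck_open_add intro: Ck_open_subset)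
qed

lemma smooth_on_sum:
  "(\<And>i. i \<in> A \<Longrightarrow> smooth_on S (f i)) \<Longrightarrow> smooth_on S (\<lambda>x. \<Sum>i\<in>A. f i x)"
  by (induction A rule: infinite_finite_induct) (auto intro: smooth_on_const smooth_on_add)

lemma smooth_on_linear_compose:
  assumes "bounded_linear h" "smooth_on S f"
  shows "smooth_on S (\<lambda>x. h (f x))"
proof (rule smooth_onI)
  fix x assume "x \<in> S"
  obtain U F where F: "open U" "x \<in> U" "\<And>k. Ck_open k U F" "\<And>y. y \<in> S \<Longrightarrow> y \<in> U \<Longrightarrow> F y = f y"
    using smooth_onE[OF assms(2) \<open>x \<in> S\<close>] by blast
  then show "\<exists>U g. open U \<and> x \<in> U \<and> (\<forall>k. Ck_open k U g) \<and> (\<forall>y\<in>S \<inter> U. g y = h (f y))"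
    by (intro exI[of _ U] exI[of _ "\<lambda>x. h (F x)"]) (auto intro!: Ck_open_linear_compose[OF assms(1)])
qed

lemma smooth_on_linear: "bounded_linear h \<Longrightarrow> smooth_on S h"
  using smooth_on_linear_compose[OF _ smooth_on_ident] by blast

lemma smooth_on_diff:
  assumes "smooth_on S f" "smooth_on S g"
  shows "smooth_on S (\<lambda>x. f x - g x)"
  using smooth_on_add[OF assms(1) smooth_on_linear_compose[OF bounded_linear_minus[OF bounded_linear_ident] assms(2)]]
  by simp

lemma smooth_on_compose:
  fixes f :: "'a::euclidean_space \<Rightarrow> 'b::euclidean_space" and g :: "'b \<Rightarrow> 'c::real_normed_vector"
  assumes "smooth_on S f" "smooth_on T g" "f ` S \<subseteq> T"
  shows "smooth_on S (\<lambda>x. g (f x))"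
proof (rule smooth_onI)
  fix x assume x: "x \<in> S"
  obtain U F where F: "open U" "x \<in> U" "\<And>k. Ck_open k U F" "\<And>y. y \<in> S \<Longrightarrow> y \<in> U \<Longrightarrow> F y = f y"
    using smooth_onE[OF assms(1) x] by blast
  have "f x \<in> T" using x assms(3) by auto
  then obtain V G where G: "open V" "f x \<in> V" "\<And>k. Ck_open k V G"
    "\<And>y. y \<in> T \<Longrightarrow> y \<in> V \<Longrightarrow> G y = g y"
    using smooth_onE[OF assms(2)] by blast
  have "continuous_on U F" using F(3)[of 0] by simp
  then have op: "open (U \<inter> F -` V)"
    using continuous_open_preimage F(1) G(1) by blast
  have "Ck_open k (U \<inter> F -` V) (\<lambda>x. G (F x))" for k
    by (rule Ck_open_compose[where V = V]) (use op F G in \<open>auto intro: Ck_open_subset\<close>)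
  then show "\<exists>U h. open U \<and> x \<in> U \<and> (\<forall>k. Ck_open k U h) \<and> (\<forall>y\<in>S \<inter> U. h y = g (f y))"
    using F G op x assms(3)
    by (intro exI[of _ "U \<inter> F -` V"] exI[of _ "\<lambda>x. G (F x)"]) (auto simp: image_subset_iff)
qed

lemma smooth_on_inverse:
  fixes f :: "'a::euclidean_space \<Rightarrow> real"
  assumes "smooth_on S f" "\<And>x. x \<in> S \<Longrightarrow> f x \<noteq> 0"
  shows "smooth_on S (\<lambda>x. inverse (f x))"
  by (rule smooth_on_compose[OF assms(1) smooth_on_Ck[of "- {0}" inverse "- {0}"]])
     (use assms(2) Ck_open_inverse in \<open>auto simp: open_Compl\<close>)

lemma smooth_on_sqrt:
  fixes f :: "'a::euclidean_space \<Rightarrow> real"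
  assumes "smooth_on S f" "\<And>x. x \<in> S \<Longrightarrow> 0 < f x"
  shows "smooth_on S (\<lambda>x. sqrt (f x))"
  by (rule smooth_on_compose[OF assms(1) smooth_on_Ck[of "{0<..}" sqrt "{0<..}"]])
     (use assms(2) Ck_open_sqrt in auto)

lemma smooth_on_componentwise:
  fixes f :: "'a::euclidean_space \<Rightarrow> real ^ 'i::finite"
  assumes "\<And>i. smooth_on S (\<lambda>x. f x $ i)"
  shows "smooth_on S f"
proof -
  have "smooth_on S (\<lambda>x. \<Sum>i\<in>UNIV. f x $ i *\<^sub>R (axis i 1 :: real ^ 'i))"
    by (intro smooth_on_sum smooth_on_bilinear[OF bounded_bilinear_scaleR] assms smooth_on_const)
  moreover have "(\<Sum>i\<in>UNIV. f x $ i *\<^sub>R (axis i 1 :: real ^ 'i)) = f x" for x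
    by (metis (no_types, lifting) basis_expansion scalar_mult_eq_scaleR sum.cong)
  ultimately show ?thesis by (simp only:)
qed

lemma smooth_on_imp_differentiable:
  assumes "smooth_on S f" "x \<in> S"
  shows "f differentiable (at x within S)"
proof -
  obtain U g where g: "open U" "x \<in> U" "\<And>k. Ck_open k U g" "\<And>y. y \<in> S \<Longrightarrow> y \<in> U \<Longrightarrow> g y = f y"
    using smooth_onE[OF assms] by blast
  obtain g' where "(g has_derivative g' x) (at x)" using g(2) g(3)[of 1] by auto
  then have "(g has_derivative g' x) (at x within S)"
    using has_derivative_at_withinI by blast
  moreover obtain e where "e > 0" "ball x e \<subseteq> U" using g(1,2) openE by blast
  ultimately have "(f has_derivative g' x) (at x within S)"
    using has_derivative_transform_within[of g "g' x" x S e f] assms(2) g(4)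
    by (auto simp: dist_commute subset_iff)
  then show ?thesis unfolding differentiable_def by blast
qed

section \<open>Relatively open subsets of affine subspaces\<close>

text \<open>A derivative within \<open>S\<close> is enough here because the curve stays in
  \<open>S\<close> near \<open>t\<close>; the result is a full derivative in the real parameter,
  hence unique.\<close>

lemma has_vector_derivative_compose_within:
  assumes "(f has_derivative f') (at (c t) within S)" "(c has_vector_derivative v) (at t)"
    and "eventually (\<lambda>s. c s \<in> S) (nhds t)"
  shows "((\<lambda>s. f (c s)) has_vector_derivative f' v) (at t)"
proof -
  obtain U where U: "open U" "t \<in> U" "\<And>s. s \<in> U \<Longrightarrow> c s \<in> S"
    using assms(3) unfolding eventually_nhds by blast
  interpret f': bounded_linear f' using assms(1) by (rule has_derivative_bounded_linear)
  have "(c has_derivative (\<lambda>x. x *\<^sub>R v)) (at t within U)"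
    using assms(2) has_derivative_at_withinI unfolding has_vector_derivative_def by blast
  then have "((\<lambda>s. f (c s)) has_derivative (\<lambda>x. f' (x *\<^sub>R v))) (at t within U)"
    using has_derivative_in_compose[of c _ t U f f'] has_derivative_subset[OF assms(1), of "c ` U"] U
    by blast
  then show ?thesis
    using at_within_open[OF U(2,1)] by (simp add: has_vector_derivative_def f'.scaleR)
qed

text \<open>Pairing the curve with a vector orthogonal to \<open>V\<close> gives a function that
  vanishes near \<open>t\<close>, so the velocity is orthogonal to the complement of
  \<open>V\<close>, and the double complement of a subspace is the subspace.\<close>

lemma vector_derivative_in_subspace:
  fixes c :: "real \<Rightarrow> 'a::euclidean_space"
  assumes "subspace V" "(c has_vector_derivative v) (at t)"
    and "eventually (\<lambda>s. c s - c t \<in> V) (nhds t)"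
  shows "v \<in> V"
proof -
  obtain U where U: "open U" "t \<in> U" "\<And>s. s \<in> U \<Longrightarrow> c s - c t \<in> V"
    using assms(3) unfolding eventually_nhds by blast
  have "w \<bullet> v = 0" if w: "w \<in> V\<^sup>\<bottom>" for w
  proof -
    have "((\<lambda>s. w \<bullet> (c s - c t)) has_derivative (\<lambda>x. w \<bullet> (x *\<^sub>R v))) (at t)"
      using assms(2) unfolding has_vector_derivative_def
      by (auto intro!: derivative_eq_intros)
    moreover have "w \<bullet> (c s - c t) = 0" if "s \<in> U" for s
      using w U(3)[OF that] by (auto simp: orthogonal_comp_def orthogonal_def inner_commute)
    ultimately have "((\<lambda>s. 0 :: real) has_derivative (\<lambda>x. w \<bullet> (x *\<^sub>R v))) (at t)"
      using has_derivative_transform_within_open[OF _ U(1,2)] by fastforce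
    then have "(\<lambda>x. w \<bullet> (x *\<^sub>R v)) = (\<lambda>x. 0)"
      using has_derivative_unique[OF _ has_derivative_const[of 0]] by blast
    from fun_cong[OF this, of 1] show ?thesis by simp
  qed
  then have "v \<in> (V\<^sup>\<bottom>)\<^sup>\<bottom>"
    by (auto simp: orthogonal_comp_def orthogonal_def inner_commute)
  then show ?thesis using orthogonal_comp_self[OF assms(1)] by simp
qed

text \<open>The two conditions on \<open>S\<close> express relative openness in an affine subspace
  with direction \<open>V\<close>, without naming a base point of that subspace.\<close>

locale flat_piece =
  fixes S V :: "'a::euclidean_space set"
  assumes subspace_V: "subspace V"
    and diff_mem: "p \<in> S \<Longrightarrow> q \<in> S \<Longrightarrow> q - p \<in> V"
    and ball_mem: "p \<in> S \<Longrightarrow> \<exists>e>0. \<forall>v\<in>V. norm v < e \<longrightarrow> p + v \<in> S"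
begin

lemma eventually_line_mem:
  assumes "p \<in> S" "v \<in> V"
  shows "eventually (\<lambda>t. p + t *\<^sub>R v \<in> S) (nhds 0)"
proof -
  obtain e where e: "e > 0" "\<forall>v\<in>V. norm v < e \<longrightarrow> p + v \<in> S" using ball_mem[OF assms(1)] by blast
  \<comment> \<open>Adding 1 keeps the radius well defined when \<open>v\<close> is zero.\<close>
  have "p + t *\<^sub>R v \<in> S" if "dist t 0 < e / (norm v + 1)" for t
  proof -
    have pos: "norm v + 1 > 0" using norm_ge_zero[of v] by linarith
    have "\<bar>t\<bar> * (norm v + 1) < e" using that pos by (simp add: field_simps)
    then have "norm (t *\<^sub>R v) < e" by (simp add: algebra_simps)
    moreover have "t *\<^sub>R v \<in> V" using assms subspace_V subspace_scale by blast
    ultimately show ?thesis using e by blast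
  qed
  moreover have "e / (norm v + 1) > 0"
    using e norm_ge_zero[of v] by (intro divide_pos_pos) linarith+
  ultimately show ?thesis unfolding eventually_nhds_metric by blast
qed

lemma line_has_derivative:
  assumes "p \<in> S" "v \<in> V" "(f has_derivative f') (at p within S)"
  shows "((\<lambda>t. f (p + t *\<^sub>R v)) has_vector_derivative f' v) (at 0)"
proof -
  have "((\<lambda>t. p + t *\<^sub>R v) has_vector_derivative v) (at 0)"
    by (auto intro!: derivative_eq_intros)
  then show ?thesis
    using has_vector_derivative_compose_within[of f f' "\<lambda>t. p + t *\<^sub>R v" 0 S v]
      eventually_line_mem assms by simp
qed

text \<open>Derivatives within \<open>S\<close> are not unique on the ambient space. In a direction
  of \<open>V\<close>, however, every one of them gives the velocity of \<open>f\<close> along the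
  line through \<open>p\<close>, so the chosen derivative agrees there with any other.\<close>

lemma frechet_derivative_eq:
  assumes "p \<in> S" "v \<in> V" "(f has_derivative f') (at p within S)"
  shows "frechet_derivative f (at p within S) v = f' v"
proof -
  have "(f has_derivative frechet_derivative f (at p within S)) (at p within S)"
    using assms(3) frechet_derivative_works differentiableI by blast
  then show ?thesis
    using line_has_derivative[OF assms(1,2)] assms(3) vector_derivative_unique_at by blast
qed

text \<open>Serves vector fields, whose derivatives thereby remain tangent, and local
  parametrizations, whose partial derivatives must be tangent to their range.\<close>

lemma frechet_derivative_mem:
  fixes f :: "'a \<Rightarrow> 'b::euclidean_space"
  assumes "subspace W" "p \<in> S" "v \<in> V" "(f has_derivative f') (at p within S)"
    and "\<And>q. q \<in> S \<Longrightarrow> f q - f p \<in> W"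
  shows "f' v \<in> W"
proof (rule vector_derivative_in_subspace[where c = "\<lambda>t. f (p + t *\<^sub>R v)",
      OF assms(1) line_has_derivative[OF assms(2-4)]])
  show "\<forall>\<^sub>F t in nhds 0. f (p + t *\<^sub>R v) - f (p + 0 *\<^sub>R v) \<in> W"
    using eventually_line_mem[OF assms(2,3)] by eventually_elim (use assms(5) in auto)
qed

lemma smooth_on_has_derivative:
  assumes "smooth_on S f" "p \<in> S"
  shows "(f has_derivative frechet_derivative f (at p within S)) (at p within S)"
  using smooth_on_imp_differentiable[OF assms] frechet_derivative_works by blast

lemma frechet_derivative_cong:
  assumes "p \<in> S" "v \<in> V" "smooth_on S f" "\<And>q. q \<in> S \<Longrightarrow> f q = g q"
  shows "frechet_derivative f (at p within S) v = frechet_derivative g (at p within S) v"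
proof -
  have "(g has_derivative frechet_derivative f (at p within S)) (at p within S)"
    using has_derivative_transform[OF assms(1) _ smooth_on_has_derivative[OF assms(3,1)], of g]
      assms(4) by auto
  then show ?thesis using frechet_derivative_eq[OF assms(1,2)] by metis
qed

lemma tangent_space_eq:
  assumes "p \<in> S"
  shows "tangent_space S p = V"
proof (intro equalityI subsetI)
  fix v assume "v \<in> tangent_space S p"
  then obtain c \<epsilon> where c: "0 < \<epsilon>" "c ` {-\<epsilon><..<\<epsilon>} \<subseteq> S" "c 0 = p"
    "(c has_vector_derivative v) (at (0::real))"
    unfolding tangent_space_def by blast
  have "eventually (\<lambda>s. s \<in> {-\<epsilon><..<\<epsilon>}) (nhds 0)"
    using c(1) by (intro eventually_nhds_in_open) auto
  then have "eventually (\<lambda>s. c s - c 0 \<in> V) (nhds 0)"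
    by eventually_elim (use diff_mem assms c in blast)
  then show "v \<in> V" using vector_derivative_in_subspace[OF subspace_V c(4)] by blast
next
  fix v assume v: "v \<in> V"
  obtain \<epsilon> where e: "\<epsilon> > 0" "\<And>t. dist t 0 < \<epsilon> \<Longrightarrow> p + t *\<^sub>R v \<in> S"
    using eventually_line_mem[OF assms v] unfolding eventually_nhds_metric by blast
  have "smooth_on {-\<epsilon><..<\<epsilon>} (\<lambda>t. p + t *\<^sub>R v)"
    by (intro smooth_on_add smooth_on_const smooth_on_linear bounded_linear_scaleR_left)
  moreover have "((\<lambda>t. p + t *\<^sub>R v) has_vector_derivative v) (at 0)"
    by (auto intro!: derivative_eq_intros)
  ultimately show "v \<in> tangent_space S p"
    unfolding tangent_space_def using e
    by (intro CollectI exI[of _ "\<lambda>t. p + t *\<^sub>R v"] exI[of _ \<epsilon>]) (auto simp: dist_real_def)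
qed

lemma smooth_vector_field_iff:
  "smooth_vector_field S X \<longleftrightarrow> smooth_on S X \<and> (\<forall>p\<in>S. X p \<in> V)"
  unfolding smooth_vector_field_def using tangent_space_eq by auto

text \<open>Near each point \<open>Y\<close> is replaced by an ambient smooth extension, whose
  derivative is unique and varies smoothly. Tangency of \<open>X\<close> makes this derivative agree
  with the chosen one within \<open>S\<close>.\<close>

lemma smooth_on_directional_derivative:
  assumes "smooth_on S Y" "smooth_on S X" "\<And>p. p \<in> S \<Longrightarrow> X p \<in> V"
  shows "smooth_on S (\<lambda>p. frechet_derivative Y (at p within S) (X p))"
proof (rule smooth_onI)
  fix x assume x: "x \<in> S"
  obtain U G where G: "open U" "x \<in> U" "\<And>k. Ck_open k U G" "\<And>y. y \<in> S \<Longrightarrow> y \<in> U \<Longrightarrow> G y = Y y"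
    using smooth_onE[OF assms(1) x] by blast
  obtain U' H where H: "open U'" "x \<in> U'" "\<And>k. Ck_open k U' H" "\<And>y. y \<in> S \<Longrightarrow> y \<in> U' \<Longrightarrow> H y = X y"
    using smooth_onE[OF assms(2) x] by blast
  define D where "D y = frechet_derivative G (at y)" for y
  have D: "(G has_derivative D y) (at y)" if "y \<in> U" for y
  proof -
    obtain G' where "(G has_derivative G' y) (at y)" using G(3)[of 1] \<open>y \<in> U\<close> by auto
    then show ?thesis unfolding D_def using frechet_derivative_works differentiableI by blast
  qed
  \<comment> \<open>The derivative that \<open>Ck_open\<close> provides may depend on the order
    \<open>k\<close>; uniqueness on an open set identifies all of these with the single
    \<open>D\<close>.\<close>
  have DC: "Ck_open k U (\<lambda>y. D y v)" for k v
  proof -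
    obtain G' where G': "\<forall>y\<in>U. (G has_derivative G' y) (at y)" "\<And>v. Ck_open k U (\<lambda>y. G' y v)"
      using G(3)[of "Suc k"] by auto
    have "G' y = D y" if "y \<in> U" for y
      using that G'(1) D has_derivative_unique by blast
    then show ?thesis using Ck_open_cong[OF G(1) _ G'(2)[of v]] by auto
  qed
  have eq: "(\<Sum>b\<in>Basis. (H y \<bullet> b) *\<^sub>R D y b) = frechet_derivative Y (at y within S) (X y)"
    if y: "y \<in> S" "y \<in> U" "y \<in> U'" for y
  proof -
    have lin: "linear (D y)" using D[OF y(2)] has_derivative_linear by blast
    have "(\<Sum>b\<in>Basis. (H y \<bullet> b) *\<^sub>R D y b) = D y (\<Sum>b\<in>Basis. (H y \<bullet> b) *\<^sub>R b)"
      using lin by (simp add: linear_sum linear_cmul)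
    also have "\<dots> = D y (X y)" using H(4) y by (simp add: euclidean_representation)
    also obtain e where e: "e > 0" "ball y e \<subseteq> U" using G(1) y openE by blast
    have "(Y has_derivative D y) (at y within S)"
      using has_derivative_transform_within[OF has_derivative_at_withinI[OF D[OF y(2)]] e(1) y(1), of Y]
        G(4) e(2) by (auto simp: dist_commute subset_iff)
    then have "D y (X y) = frechet_derivative Y (at y within S) (X y)"
      using frechet_derivative_eq[OF y(1) assms(3)[OF y(1)]] by metis
    finally show ?thesis .
  qed
  have "Ck_open k (U \<inter> U') (\<lambda>y. \<Sum>b\<in>Basis. (H y \<bullet> b) *\<^sub>R D y b)" for k
    by (intro Ck_open_sum Ck_open_bilinear[OF bounded_bilinear_scaleR]
        Ck_open_linear_compose[OF bounded_linear_inner_left]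
        Ck_open_subset[OF DC] Ck_open_subset[OF H(3)]) auto
  then show "\<exists>U F. open U \<and> x \<in> U \<and> (\<forall>k. Ck_open k U F) \<and>
      (\<forall>y\<in>S \<inter> U. F y = frechet_derivative Y (at y within S) (X y))"
    using G(1,2) H(1,2) eq
    by (intro exI[of _ "U \<inter> U'"] exI[of _ "\<lambda>y. \<Sum>b\<in>Basis. (H y \<bullet> b) *\<^sub>R D y b"]) auto
qed

lemma directional_derivative_mem:
  assumes "smooth_vector_field S Y" "p \<in> S" "v \<in> V"
  shows "frechet_derivative Y (at p within S) v \<in> V"
  using assms subspace_V unfolding smooth_vector_field_iff
  by (intro frechet_derivative_mem[OF subspace_V assms(2,3) smooth_on_has_derivative])
     (auto intro: subspace_diff)

lemma smooth_vector_field_lie_bracket: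
  assumes "smooth_vector_field S X" "smooth_vector_field S Y"
  shows "smooth_vector_field S (lie_bracket S X Y)"
proof -
  have "smooth_on S (lie_bracket S X Y)"
    unfolding lie_bracket_def[abs_def] using assms[unfolded smooth_vector_field_iff]
    by (intro smooth_on_diff smooth_on_directional_derivative) auto
  moreover have "lie_bracket S X Y p \<in> V" if "p \<in> S" for p
    unfolding lie_bracket_def
    using that assms directional_derivative_mem[OF assms(1) that] directional_derivative_mem[OF assms(2) that]
    by (auto intro!: subspace_diff[OF subspace_V] simp: smooth_vector_field_iff)
  ultimately show ?thesis unfolding smooth_vector_field_iff by blast
qed

text \<open>One global chart suffices: translation by a point of \<open>S\<close>, defined on the
  part of \<open>V\<close> that it carries into \<open>S\<close>.\<close>

lemma embedded_submanifold_flat_piece: "embedded_submanifold (dim V) S"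
  unfolding embedded_submanifold_def
proof
  fix p assume p: "p \<in> S"
  obtain B where B: "B \<subseteq> V" "independent B" "V \<subseteq> span B" "card B = dim V"
    using basis_exists by blast
  then have spanB: "span B = V" using span_minimal[OF B(1) subspace_V] by blast
  have "finite B" using B(2) independent_bound by blast
  then obtain b where "bij_betw b {0..<card B} B" using ex_bij_betw_nat_finite by blast
  then have b: "inj_on b {..<dim V}" "b ` {..<dim V} = B"
    using B(4) by (auto simp: bij_betw_def atLeast0LessThan)
  define W where "W = {v \<in> V. p + v \<in> S}"
  define \<psi> where "\<psi> v = p + v" for v
  have im: "\<psi> ` W = S"
  proof (intro equalityI subsetI)
    fix q assume "q \<in> S"
    then show "q \<in> \<psi> ` W"
      using diff_mem[OF p, of q] by (intro image_eqI[of _ _ "q - p"]) (auto simp: W_def \<psi>_def)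
  qed (auto simp: W_def \<psi>_def)
  have inj: "inj_on \<psi> W" by (auto simp: inj_on_def \<psi>_def)
  have "\<exists>e>0. ball v e \<inter> V \<subseteq> W" if v: "v \<in> W" for v
  proof -
    obtain e where e: "e > 0" "\<forall>u\<in>V. norm u < e \<longrightarrow> (p + v) + u \<in> S"
      using ball_mem[of "p + v"] v unfolding W_def by blast
    have "u \<in> W" if "u \<in> ball v e" "u \<in> V" for u
    proof -
      have "u - v \<in> V" using that v subspace_V subspace_diff by (auto simp: W_def)
      moreover have "norm (u - v) < e" using that by (simp add: dist_norm norm_minus_commute)
      ultimately have "(p + v) + (u - v) \<in> S" using e(2) by blast
      then show ?thesis using that by (simp add: W_def)
    qed
    then show ?thesis using e(1) by blast
  qed
  then have opW: "openin (top_of_set V) W"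
    unfolding openin_contains_ball by (auto simp: W_def)
  have "smooth_on S (\<lambda>q. q - p)"
    by (intro smooth_on_diff smooth_on_ident smooth_on_const)
  moreover have "inv_into W \<psi> q = q - p" if "q \<in> S" for q
  proof -
    have "q - p \<in> W" using diff_mem[OF p that] that by (simp add: W_def)
    from inv_into_f_f[OF inj this] show ?thesis by (simp add: \<psi>_def)
  qed
  ultimately have "smooth_on S (inv_into W \<psi>)"
    using smooth_on_cong[of S "inv_into W \<psi>" "\<lambda>q. q - p"] by blast
  moreover have "smooth_on W \<psi>"
    unfolding \<psi>_def by (intro smooth_on_add smooth_on_ident smooth_on_const)
  ultimately have "diffeomorphism W (\<psi> ` W) \<psi>"
    unfolding diffeomorphism_def im using inj im by (simp add: bij_betw_def)
  then have "local_parametrization (dim V) S b W \<psi>"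
    unfolding local_parametrization_def using b B(2) spanB opW im by simp
  then show "\<exists>b W \<psi>. local_parametrization (dim V) S b W \<psi> \<and> p \<in> \<psi> ` W"
    using p im by blast
qed

end

text \<open>Makes the domain of a local parametrization a flat piece, so that the partial
  derivatives in \<open>parametrized_volume\<close> are well determined.\<close>

lemma flat_piece_openin:
  assumes "subspace V" "openin (top_of_set V) W"
  shows "flat_piece W V"
proof
  have sub: "W \<subseteq> V" using openin_imp_subset[OF assms(2)] .
  show "q - p \<in> V" if "p \<in> W" "q \<in> W" for p q
    using that sub subspace_diff[OF assms(1)] by blast
  fix p assume p: "p \<in> W"
  then obtain e where e: "e > 0" "ball p e \<inter> V \<subseteq> W" using assms(2) unfolding openin_contains_ball by blast
  have "p + v \<in> W" if "v \<in> V" "norm v < e" for v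
  proof -
    have "p + v \<in> V" using that p sub subspace_add[OF assms(1)] by blast
    moreover have "p + v \<in> ball p e" using that by (simp add: dist_norm)
    ultimately show ?thesis using e(2) by blast
  qed
  then show "\<exists>e>0. \<forall>v\<in>V. norm v < e \<longrightarrow> p + v \<in> W" using e(1) by blast
qed (fact assms(1))

section \<open>The Levi-Civita connection of the Fisher-Rao metric\<close>

text \<open>For the diagonal metric with entries 1 / p_i on the positive orthant, the Christoffel
  term is -1/2 times this vector. At coordinates outside \<open>I\<close>, where points of the
  simplex are 0, division by zero yields 0.\<close>

definition fisher_prod :: "real ^ 'i::finite \<Rightarrow> real ^ 'i \<Rightarrow> real ^ 'i \<Rightarrow> real ^ 'i" where
  "fisher_prod p u v = (\<chi> i. u $ i * v $ i / p $ i)"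

lemma fisher_rao_commute: "fisher_rao I p u v = fisher_rao I p v u"
  unfolding fisher_rao_def by (simp add: mult.commute)

lemma fisher_rao_left_linear:
  "fisher_rao I p (a *\<^sub>R u + v) w = a * fisher_rao I p u w + fisher_rao I p v w"
  unfolding fisher_rao_def
  by (simp add: sum_distrib_left sum.distrib[symmetric] algebra_simps add_divide_distrib)

lemma fisher_rao_diff: "fisher_rao I p (u - v) w = fisher_rao I p u w - fisher_rao I p v w"
  using fisher_rao_left_linear[of I p "-1" v u w] by simp

text \<open>The last condition says that the Christoffel term of the Fisher-Rao simplex maps pairs of
  tangent vectors of \<open>S\<close> to tangent vectors, so that \<open>S\<close> is totally geodesic.\<close>

locale fisher_piece = flat_piece S V for I :: "'i::finite set" and S V :: "(real ^ 'i) set" +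
  assumes pos: "p \<in> S \<Longrightarrow> i \<in> I \<Longrightarrow> 0 < p $ i"
    and V_off: "v \<in> V \<Longrightarrow> i \<notin> I \<Longrightarrow> v $ i = 0"
    and V_sum: "v \<in> V \<Longrightarrow> (\<Sum>i\<in>I. v $ i) = 0"
    and christoffel_mem: "p \<in> S \<Longrightarrow> u \<in> V \<Longrightarrow> v \<in> V \<Longrightarrow>
      fisher_prod p u v - fisher_rao I p u v *\<^sub>R p \<in> V"
begin

lemma fisher_rao_pos:
  assumes "p \<in> S" "u \<in> V" "u \<noteq> 0"
  shows "0 < fisher_rao I p u u"
proof -
  obtain i where i: "u $ i \<noteq> 0" using assms(3) by (auto simp: vec_eq_iff)
  then have "i \<in> I" using V_off assms(2) by blast
  then show ?thesis
    unfolding fisher_rao_def using i pos[OF assms(1)]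
    by (intro sum_pos2[of I i]) (auto simp: zero_less_mult_iff linorder_neq_iff intro!: divide_pos_pos divide_nonneg_pos)
qed

lemma smooth_on_fisher_rao:
  assumes "smooth_on S X" "smooth_on S Y"
  shows "smooth_on S (\<lambda>p. fisher_rao I p (X p) (Y p))"
proof -
  have comp: "smooth_on S (\<lambda>p. F p $ i)" if "smooth_on S F" for F :: "real ^ 'i \<Rightarrow> real ^ 'i" and i
    using smooth_on_linear_compose[OF bounded_linear_vec_nth that] .
  have "smooth_on S (\<lambda>p. \<Sum>i\<in>I. X p $ i * Y p $ i * inverse (p $ i))"
    using pos by (intro smooth_on_sum smooth_on_bilinear[OF bounded_bilinear_mult] comp assms
        smooth_on_inverse smooth_on_ident) fastforce
  then show ?thesis by (simp add: fisher_rao_def divide_inverse)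
qed

lemma riemannian_manifold: "riemannian_manifold (dim V) S (fisher_rao I)"
  unfolding riemannian_manifold_def riemannian_metric_def
  using embedded_submanifold_flat_piece
  by (auto simp: tangent_space_eq fisher_rao_left_linear fisher_rao_pos smooth_vector_field_iff
      intro: fisher_rao_commute smooth_on_fisher_rao)

text \<open>The third summand comes from differentiating the denominator; since coordinate
  derivatives are flat, it is the only source of Christoffel terms.\<close>

lemma fisher_rao_has_derivative:
  assumes "smooth_on S Y" "smooth_on S Z" "p \<in> S"
  shows "((\<lambda>q. fisher_rao I q (Y q) (Z q)) has_derivative
    (\<lambda>v. \<Sum>i\<in>I. frechet_derivative Y (at p within S) v $ i * Z p $ i / p $ i
          + Y p $ i * frechet_derivative Z (at p within S) v $ i / p $ i
          - Y p $ i * Z p $ i * v $ i / (p $ i * p $ i))) (at p within S)"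
proof -
  note comp = bounded_linear.has_derivative[OF bounded_linear_vec_nth]
  have "((\<lambda>q. Y q $ i * Z q $ i / q $ i) has_derivative
    (\<lambda>v. frechet_derivative Y (at p within S) v $ i * Z p $ i / p $ i
          + Y p $ i * frechet_derivative Z (at p within S) v $ i / p $ i
          - Y p $ i * Z p $ i * v $ i / (p $ i * p $ i))) (at p within S)" if "i \<in> I" for i
    using pos[OF assms(3) that]
    by (auto intro!: derivative_eq_intros comp[OF smooth_on_has_derivative[OF assms(1,3)]]
        comp[OF smooth_on_has_derivative[OF assms(2,3)]] comp[OF has_derivative_ident]
        simp: fun_eq_iff field_simps)
  then show ?thesis unfolding fisher_rao_def by (rule has_derivative_sum)
qed

text \<open>In the Koszul expression the derivatives of the fields combine to 2 g(D_X Y, Z), and the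
  cubic terms X Y Z / p^2 enter with signs -, -, +, leaving one with sign -. This determines
  \<open>w\<close> up to a multiple of \<open>p\<close>, which is orthogonal to all tangent vectors;
  \<open>christoffel_mem\<close> says that the coefficient g(X, Y) makes the result tangent.\<close>

theorem levi_civita_eq:
  assumes X: "smooth_vector_field S X" and Y: "smooth_vector_field S Y" and p: "p \<in> S"
  shows "levi_civita S (fisher_rao I) X Y p = frechet_derivative Y (at p within S) (X p)
    - (1/2) *\<^sub>R (fisher_prod p (X p) (Y p) - fisher_rao I p (X p) (Y p) *\<^sub>R p)" (is "_ = ?w")
proof -
  have Xp: "X p \<in> V" and Yp: "Y p \<in> V" using X Y p by (auto simp: smooth_vector_field_iff)
  have w: "?w \<in> V"
    by (rule subspace_diff[OF subspace_V directional_derivative_mem[OF Y p Xp]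
          subspace_scale[OF subspace_V christoffel_mem[OF p Xp Yp]]])
  define R where "R Z = frechet_derivative (\<lambda>q. fisher_rao I q (Y q) (Z q)) (at p within S) (X p)
    + frechet_derivative (\<lambda>q. fisher_rao I q (Z q) (X q)) (at p within S) (Y p)
    - frechet_derivative (\<lambda>q. fisher_rao I q (X q) (Y q)) (at p within S) (Z p)
    + fisher_rao I p (lie_bracket S X Y p) (Z p)
    - fisher_rao I p (lie_bracket S X Z p) (Y p)
    - fisher_rao I p (lie_bracket S Y Z p) (X p)" for Z
  have koszul: "2 * fisher_rao I p ?w (Z p) = R Z" if Z: "smooth_vector_field S Z" for Z
  proof -
    have Zp: "Z p \<in> V" using Z p by (auto simp: smooth_vector_field_iff)
    have sm: "smooth_on S X" "smooth_on S Y" "smooth_on S Z"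
      using X Y Z by (auto simp: smooth_vector_field_iff)
    let ?D = "\<lambda>F. frechet_derivative F (at p within S)"
    let ?c = "fisher_rao I p (X p) (Y p)"
    have "2 * fisher_rao I p ?w (Z p) =
      (\<Sum>i\<in>I. 2 * (?D Y (X p) $ i * Z p $ i / p $ i) - X p $ i * Y p $ i * Z p $ i / (p $ i * p $ i)
        + ?c * Z p $ i)"
      unfolding fisher_rao_def[of I p ?w] sum_distrib_left
    proof (rule sum.cong[OF refl])
      fix i assume "i \<in> I"
      then have "p $ i \<noteq> 0" using pos[OF p] by fastforce
      then show "2 * (?w $ i * Z p $ i / p $ i) = 2 * (?D Y (X p) $ i * Z p $ i / p $ i)
          - X p $ i * Y p $ i * Z p $ i / (p $ i * p $ i) + ?c * Z p $ i"
        by (simp add: fisher_prod_def field_simps)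
    qed
    \<comment> \<open>The multiple of \<open>p\<close> disappears, because its pairing with
      \<open>Z p\<close> is a multiple of the coordinate sum of \<open>Z p\<close>, which is
      0.\<close>
    also have "\<dots> = (\<Sum>i\<in>I. 2 * (?D Y (X p) $ i * Z p $ i / p $ i)
        - X p $ i * Y p $ i * Z p $ i / (p $ i * p $ i))"
      using V_sum[OF Zp] by (simp add: sum.distrib sum_distrib_left[symmetric])
    also have "\<dots> = R Z"
      unfolding R_def lie_bracket_def
        frechet_derivative_eq[OF p Xp fisher_rao_has_derivative[OF sm(2,3) p]]
        frechet_derivative_eq[OF p Yp fisher_rao_has_derivative[OF sm(3,1) p]]
        frechet_derivative_eq[OF p Zp fisher_rao_has_derivative[OF sm(1,2) p]]
      unfolding fisher_rao_def sum.distrib[symmetric] sum_subtractf[symmetric]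
      by (intro sum.cong refl) (simp add: algebra_simps diff_divide_distrib)
    finally show ?thesis .
  qed
  have uniq: "w' = ?w" if w': "w' \<in> V" "\<And>Z. smooth_vector_field S Z \<Longrightarrow> 2 * fisher_rao I p w' (Z p) = R Z" for w'
  proof (rule ccontr)
    assume "w' \<noteq> ?w"
    then have "0 < fisher_rao I p (w' - ?w) (w' - ?w)"
      using fisher_rao_pos[OF p] subspace_diff[OF subspace_V w'(1) w] by simp
    \<comment> \<open>The difference of two solutions serves as a constant test field; it is tangent
      everywhere because \<open>V\<close> does not depend on the point.\<close>
    moreover have Z: "smooth_vector_field S (\<lambda>_. w' - ?w)"
      unfolding smooth_vector_field_iff using subspace_diff[OF subspace_V w'(1) w]
      by (auto intro: smooth_on_const)
    from koszul[OF Z] w'(2)[OF Z] have "fisher_rao I p (w' - ?w) (w' - ?w) = 0"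
      unfolding fisher_rao_diff[of I p w' ?w] by linarith
    ultimately show False by simp
  qed
  show ?thesis
    unfolding levi_civita_def R_def[symmetric] tangent_space_eq[OF p]
  proof (rule the_equality)
    show "?w \<in> V \<and> (\<forall>Z. smooth_vector_field S Z \<longrightarrow> 2 * fisher_rao I p ?w (Z p) = R Z)"
      using w koszul by simp
    show "w' = ?w" if "w' \<in> V \<and> (\<forall>Z. smooth_vector_field S Z \<longrightarrow> 2 * fisher_rao I p w' (Z p) = R Z)" for w'
      by (rule uniq[OF conjunct1[OF that] mp[OF spec[OF conjunct2[OF that]]]])
  qed
qed

lemma smooth_vector_field_cong:
  assumes "smooth_vector_field S X" "\<And>p. p \<in> S \<Longrightarrow> X p = X' p"
  shows "smooth_vector_field S X'"
  using assms smooth_on_cong[of S X X'] unfolding smooth_vector_field_iff by auto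

lemma smooth_vector_field_levi_civita:
  assumes X: "smooth_vector_field S X" and Y: "smooth_vector_field S Y"
  shows "smooth_vector_field S (levi_civita S (fisher_rao I) X Y)"
proof (rule smooth_vector_field_cong[OF _ levi_civita_eq[OF X Y, symmetric]])
  have sm: "smooth_on S X" "smooth_on S Y" and mem: "\<And>p. p \<in> S \<Longrightarrow> X p \<in> V" "\<And>p. p \<in> S \<Longrightarrow> Y p \<in> V"
    using X Y by (auto simp: smooth_vector_field_iff)
  have "smooth_on S (\<lambda>p. fisher_prod p (X p) (Y p))"
  proof (rule smooth_on_componentwise)
    fix i
    show "smooth_on S (\<lambda>p. fisher_prod p (X p) (Y p) $ i)"
    proof (cases "i \<in> I")
      case True
      have "smooth_on S (\<lambda>p. X p $ i * Y p $ i * inverse (p $ i))"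
        using pos[OF _ True] by (intro smooth_on_bilinear[OF bounded_bilinear_mult] smooth_on_inverse
            smooth_on_linear_compose[OF bounded_linear_vec_nth] sm smooth_on_ident) fastforce
      then show ?thesis by (simp add: fisher_prod_def divide_inverse)
    next
      case False
      have "fisher_prod p (X p) (Y p) $ i = 0" if "p \<in> S" for p
        using V_off[OF mem(1)[OF that] False] by (simp add: fisher_prod_def)
      then show ?thesis
        using smooth_on_cong[of S "\<lambda>p. fisher_prod p (X p) (Y p) $ i" "\<lambda>p. 0"] smooth_on_const by simp
    qed
  qed
  then have "smooth_on S (\<lambda>p. frechet_derivative Y (at p within S) (X p)
      - (1/2) *\<^sub>R (fisher_prod p (X p) (Y p) - fisher_rao I p (X p) (Y p) *\<^sub>R p))"
    by (intro smooth_on_diff smooth_on_directional_derivative sm mem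
        smooth_on_linear_compose[OF bounded_linear_scaleR_right]
        smooth_on_bilinear[OF bounded_bilinear_scaleR] smooth_on_fisher_rao smooth_on_ident)
  moreover have "frechet_derivative Y (at p within S) (X p)
      - (1/2) *\<^sub>R (fisher_prod p (X p) (Y p) - fisher_rao I p (X p) (Y p) *\<^sub>R p) \<in> V" if p: "p \<in> S" for p
    by (rule subspace_diff[OF subspace_V directional_derivative_mem[OF Y p mem(1)[OF p]]
          subspace_scale[OF subspace_V christoffel_mem[OF p mem(1)[OF p] mem(2)[OF p]]]])
  ultimately show "smooth_vector_field S (\<lambda>p. frechet_derivative Y (at p within S) (X p)
      - (1/2) *\<^sub>R (fisher_prod p (X p) (Y p) - fisher_rao I p (X p) (Y p) *\<^sub>R p))"
    unfolding smooth_vector_field_iff by blast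
qed auto

text \<open>Curvature nests connections and brackets, and the transported inner fields are known to
  agree on the manifold only, not as functions on the ambient space.\<close>

lemma levi_civita_cong:
  assumes "smooth_vector_field S X" "smooth_vector_field S Y" "p \<in> S"
    and "\<And>q. q \<in> S \<Longrightarrow> X q = X' q" "\<And>q. q \<in> S \<Longrightarrow> Y q = Y' q"
  shows "levi_civita S (fisher_rao I) X Y p = levi_civita S (fisher_rao I) X' Y' p"
proof -
  have "smooth_vector_field S X'" "smooth_vector_field S Y'"
    using smooth_vector_field_cong assms by blast+
  moreover have "frechet_derivative Y (at p within S) (X p) = frechet_derivative Y' (at p within S) (X p)"
    using assms by (intro frechet_derivative_cong) (auto simp: smooth_vector_field_iff)
  ultimately show ?thesis using assms by (simp add: levi_civita_eq)
qed

end

section \<open>Linear isometries\<close>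

lemma smooth_on_has_vector_derivative:
  assumes "smooth_on I c" "open I" "t \<in> I"
  shows "(c has_vector_derivative vector_derivative c (at t)) (at t)"
  using smooth_on_imp_differentiable[OF assms(1,3)] at_within_open[OF assms(3,2)]
  by (simp add: vector_derivative_works)

text \<open>The axioms are symmetric in the two sides, so each result also holds for \<open>G\<close>.\<close>

locale linear_fisher_isometry =
  S: fisher_piece I S V + T: fisher_piece J T W
  for I :: "'i::finite set" and S V and J :: "'j::finite set" and T W +
  fixes M :: "real ^ 'i \<Rightarrow> real ^ 'j" and G :: "real ^ 'j \<Rightarrow> real ^ 'i"
  assumes linear_M: "linear M" and linear_G: "linear G"
    and M_S: "p \<in> S \<Longrightarrow> M p \<in> T" and G_T: "q \<in> T \<Longrightarrow> G q \<in> S"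
    and GM_S: "p \<in> S \<Longrightarrow> G (M p) = p" and MG_T: "q \<in> T \<Longrightarrow> M (G q) = q"
    and M_V: "v \<in> V \<Longrightarrow> M v \<in> W" and G_W: "w \<in> W \<Longrightarrow> G w \<in> V"
    and GM_V: "v \<in> V \<Longrightarrow> G (M v) = v" and MG_W: "w \<in> W \<Longrightarrow> M (G w) = w"
    and M_prod: "p \<in> S \<Longrightarrow> u \<in> V \<Longrightarrow> v \<in> V \<Longrightarrow>
      M (fisher_prod p u v) = fisher_prod (M p) (M u) (M v)"
    and G_prod: "q \<in> T \<Longrightarrow> x \<in> W \<Longrightarrow> y \<in> W \<Longrightarrow>
      G (fisher_prod q x y) = fisher_prod (G q) (G x) (G y)"
    and M_metric: "p \<in> S \<Longrightarrow> u \<in> V \<Longrightarrow> v \<in> V \<Longrightarrow>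
      fisher_rao J (M p) (M u) (M v) = fisher_rao I p u v"
begin

lemma swap: "linear_fisher_isometry J T W I S V G M"
proof
  show "fisher_rao I (G q) (G x) (G y) = fisher_rao J q x y" if "q \<in> T" "x \<in> W" "y \<in> W" for q x y
    using M_metric[OF G_T G_W G_W, OF that] that by (simp add: MG_T MG_W)
qed (simp_all add: linear_add[OF linear_M] linear_add[OF linear_G] linear_cmul[OF linear_M]
    linear_cmul[OF linear_G] M_S G_T GM_S MG_T M_V G_W GM_V MG_W M_prod G_prod)

lemma bounded_linear_M: "bounded_linear M"
  using linear_M linear_conv_bounded_linear by blast

lemma bounded_linear_G: "bounded_linear G"
  using linear_G linear_conv_bounded_linear by blast

lemma inj_on_M: "inj_on M S"
  by (rule inj_on_inverseI[of _ G]) (simp add: GM_S)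

lemma inv_into_M:
  assumes "q \<in> T"
  shows "inv_into S M q = G q"
  using inv_into_f_f[OF inj_on_M G_T[OF assms]] MG_T[OF assms] by simp

lemma diffeomorphism_M: "diffeomorphism S T M"
proof -
  have "bij_betw M S T" by (rule bij_betw_byWitness[of _ G]) (auto simp: GM_S MG_T M_S G_T)
  moreover have "smooth_on T (inv_into S M)"
    using smooth_on_cong[of T "inv_into S M" G] inv_into_M smooth_on_linear[OF bounded_linear_G] by blast
  ultimately show ?thesis
    unfolding diffeomorphism_def using smooth_on_linear[OF bounded_linear_M] by blast
qed

lemma frechet_derivative_M:
  assumes "p \<in> S" "v \<in> V"
  shows "frechet_derivative M (at p within S) v = M v"
  by (rule S.frechet_derivative_eq[OF assms bounded_linear_imp_has_derivative[OF bounded_linear_M]])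

lemma isometry: "riemannian_isometry S (fisher_rao I) T (fisher_rao J) M"
  unfolding riemannian_isometry_def using diffeomorphism_M
  by (auto simp: S.tangent_space_eq frechet_derivative_M M_metric)

text \<open>Tangency is asked at a single point only, so that this also applies to the curvature,
  for which just membership in \<open>V\<close> is shown.\<close>

lemma pushforward_eq:
  assumes "q \<in> T" "X (G q) \<in> V"
  shows "pushforward S M X q = M (X (G q))"
  unfolding pushforward_def inv_into_M[OF assms(1)]
  by (rule frechet_derivative_M[OF G_T[OF assms(1)] assms(2)])

lemma pushforward_vector_field:
  assumes "smooth_vector_field S X" "q \<in> T"
  shows "pushforward S M X q = M (X (G q))"
  using pushforward_eq assms G_T by (simp add: S.smooth_vector_field_iff)

lemma smooth_vector_field_pushforward:
  assumes "smooth_vector_field S X"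
  shows "smooth_vector_field T (pushforward S M X)"
proof (rule T.smooth_vector_field_cong[OF _ pushforward_vector_field[OF assms, symmetric]])
  have X: "smooth_on S X" "\<And>p. p \<in> S \<Longrightarrow> X p \<in> V" using assms by (auto simp: S.smooth_vector_field_iff)
  have "smooth_on T (\<lambda>q. X (G q))"
    by (rule smooth_on_compose[OF smooth_on_linear[OF bounded_linear_G] X(1)]) (auto simp: G_T)
  then show "smooth_vector_field T (\<lambda>q. M (X (G q)))"
    unfolding T.smooth_vector_field_iff using X(2) G_T M_V
    by (auto intro: smooth_on_linear_compose[OF bounded_linear_M])
qed

text \<open>The pushed field is M o Y o G, and since both outer maps are linear the chain rule
  produces no second derivative of the coordinate change.\<close>

lemma directional_derivative_pushforward:
  assumes Y: "smooth_vector_field S Y" and q: "q \<in> T" and w: "w \<in> W"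
  shows "frechet_derivative (pushforward S M Y) (at q within T) w
    = M (frechet_derivative Y (at (G q) within S) (G w))"
proof -
  have "(Y has_derivative frechet_derivative Y (at (G q) within S)) (at (G q) within S)"
    by (rule S.smooth_on_has_derivative[OF _ G_T[OF q]]) (use Y in \<open>simp add: S.smooth_vector_field_iff\<close>)
  then have "(Y has_derivative frechet_derivative Y (at (G q) within S)) (at (G q) within G ` T)"
    by (rule has_derivative_subset) (auto simp: G_T)
  from has_derivative_in_compose[OF bounded_linear_imp_has_derivative[OF bounded_linear_G] this]
  have "((\<lambda>q. M (Y (G q))) has_derivative (\<lambda>w. M (frechet_derivative Y (at (G q) within S) (G w))))
      (at q within T)"
    by (rule bounded_linear.has_derivative[OF bounded_linear_M])
  then have "((pushforward S M Y) has_derivative (\<lambda>w. M (frechet_derivative Y (at (G q) within S) (G w))))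
      (at q within T)"
    by (rule has_derivative_transform[OF q, rotated]) (simp add: pushforward_vector_field[OF Y])
  from T.frechet_derivative_eq[OF q w this] show ?thesis .
qed

section \<open>Transport of connection, bracket, curvature and geodesics\<close>

lemma levi_civita_pushforward:
  assumes X: "smooth_vector_field S X" and Y: "smooth_vector_field S Y" and q: "q \<in> T"
  shows "levi_civita T (fisher_rao J) (pushforward S M X) (pushforward S M Y) q
    = M (levi_civita S (fisher_rao I) X Y (G q))"
proof -
  have XV: "X (G q) \<in> V" and YV: "Y (G q) \<in> V"
    using X Y G_T[OF q] by (auto simp: S.smooth_vector_field_iff)
  show ?thesis
    unfolding T.levi_civita_eq[OF smooth_vector_field_pushforward[OF X]
        smooth_vector_field_pushforward[OF Y] q] S.levi_civita_eq[OF X Y G_T[OF q]]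
      pushforward_vector_field[OF X q] pushforward_vector_field[OF Y q]
      directional_derivative_pushforward[OF Y q M_V[OF XV]]
    using M_prod[OF G_T[OF q] XV YV] M_metric[OF G_T[OF q] XV YV]
    by (simp add: GM_V[OF XV] MG_T[OF q] linear_diff[OF linear_M] linear_cmul[OF linear_M])
qed

lemma lie_bracket_pushforward:
  assumes X: "smooth_vector_field S X" and Y: "smooth_vector_field S Y" and q: "q \<in> T"
  shows "lie_bracket T (pushforward S M X) (pushforward S M Y) q = M (lie_bracket S X Y (G q))"
proof -
  have XV: "X (G q) \<in> V" and YV: "Y (G q) \<in> V"
    using X Y G_T[OF q] by (auto simp: S.smooth_vector_field_iff)
  show ?thesis
    unfolding lie_bracket_def pushforward_vector_field[OF X q] pushforward_vector_field[OF Y q]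
      directional_derivative_pushforward[OF Y q M_V[OF XV]]
      directional_derivative_pushforward[OF X q M_V[OF YV]]
    by (simp add: GM_V XV YV linear_diff[OF linear_M])
qed

lemma connection: "preserves_connection S (fisher_rao I) T (fisher_rao J) M"
  unfolding preserves_connection_def
  using levi_civita_pushforward pushforward_vector_field S.smooth_vector_field_levi_civita by simp

lemma riemann_curvature_pushforward:
  assumes X: "smooth_vector_field S X" and Y: "smooth_vector_field S Y"
    and Z: "smooth_vector_field S Z" and q: "q \<in> T"
  shows "riemann_curvature T (fisher_rao J) (pushforward S M X) (pushforward S M Y) (pushforward S M Z) q
    = M (riemann_curvature S (fisher_rao I) X Y Z (G q))"
proof -
  note push = smooth_vector_field_pushforward
  note nabla = S.smooth_vector_field_levi_civita
  \<comment> \<open>The fields are generalized because curvature uses the second covariant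
    derivative in both orders of \<open>X\<close> and \<open>Y\<close>.\<close>
  have second: "levi_civita T (fisher_rao J) (pushforward S M X)
      (levi_civita T (fisher_rao J) (pushforward S M Y) (pushforward S M Z)) q
    = M (levi_civita S (fisher_rao I) X (levi_civita S (fisher_rao I) Y Z) (G q))"
    if X: "smooth_vector_field S X" and Y: "smooth_vector_field S Y" for X Y
  proof -
    have "levi_civita T (fisher_rao J) (pushforward S M X)
        (levi_civita T (fisher_rao J) (pushforward S M Y) (pushforward S M Z)) q
      = levi_civita T (fisher_rao J) (pushforward S M X)
        (pushforward S M (levi_civita S (fisher_rao I) Y Z)) q"
      by (rule T.levi_civita_cong[symmetric, OF push[OF X] push[OF nabla[OF Y Z]] q])
         (simp_all add: levi_civita_pushforward[OF Y Z] pushforward_vector_field[OF nabla[OF Y Z]])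
    then show ?thesis using levi_civita_pushforward[OF X nabla[OF Y Z] q] by simp
  qed
  have XY: "smooth_vector_field S (lie_bracket S X Y)"
    by (rule S.smooth_vector_field_lie_bracket[OF X Y])
  have "levi_civita T (fisher_rao J) (lie_bracket T (pushforward S M X) (pushforward S M Y)) (pushforward S M Z) q
    = levi_civita T (fisher_rao J) (pushforward S M (lie_bracket S X Y)) (pushforward S M Z) q"
    by (rule T.levi_civita_cong[symmetric, OF push[OF XY] push[OF Z] q])
       (simp_all add: lie_bracket_pushforward[OF X Y] pushforward_vector_field[OF XY])
  also have "\<dots> = M (levi_civita S (fisher_rao I) (lie_bracket S X Y) Z (G q))"
    by (rule levi_civita_pushforward[OF XY Z q])
  finally show ?thesis
    unfolding riemann_curvature_def second[OF X Y] second[OF Y X]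
    by (simp add: linear_diff[OF linear_M])
qed

lemma riemann_curvature_mem:
  assumes "smooth_vector_field S X" "smooth_vector_field S Y" "smooth_vector_field S Z" "p \<in> S"
  shows "riemann_curvature S (fisher_rao I) X Y Z p \<in> V"
proof -
  note nabla = S.smooth_vector_field_levi_civita
  have "smooth_vector_field S (levi_civita S (fisher_rao I) X (levi_civita S (fisher_rao I) Y Z))"
    "smooth_vector_field S (levi_civita S (fisher_rao I) Y (levi_civita S (fisher_rao I) X Z))"
    "smooth_vector_field S (levi_civita S (fisher_rao I) (lie_bracket S X Y) Z)"
    by (intro nabla assms S.smooth_vector_field_lie_bracket)+
  then show ?thesis
    unfolding riemann_curvature_def S.smooth_vector_field_iff using assms(4)
    by (intro subspace_diff S.subspace_V) auto
qed

lemma curvature: "preserves_curvature S (fisher_rao I) T (fisher_rao J) M"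
  unfolding preserves_curvature_def
  by (simp add: riemann_curvature_pushforward pushforward_eq riemann_curvature_mem G_T)

text \<open>The same coefficient functions work with the pushed frame fields. The curve
  \<open>c'\<close> and the field \<open>U'\<close> are tied to the images only near
  \<open>t\<close>, since a geodesic is constrained on its interval alone.\<close>

lemma has_covariant_derivative_pushforward:
  assumes cov: "has_covariant_derivative S (fisher_rao I) c U t w"
    and c: "eventually (\<lambda>s. c s \<in> S) (nhds t)" "(c has_vector_derivative v) (at t)"
    and c': "c' t = M (c t)" "(c' has_vector_derivative M v) (at t)"
      "eventually (\<lambda>s. c' s = M (c s)) (nhds t)"
    and U': "eventually (\<lambda>s. U' s = M (U s)) (nhds t)"
  shows "has_covariant_derivative T (fisher_rao J) c' U' t (M w)"
proof -
  from cov obtain n :: nat and E a a' X where *: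
    "\<And>j. j < n \<Longrightarrow> smooth_vector_field S (E j)"
    "\<And>j. j < n \<Longrightarrow> (a j has_real_derivative a' j) (at t)"
    "eventually (\<lambda>s. U s = (\<Sum>j<n. a j s *\<^sub>R E j (c s))) (nhds t)"
    "smooth_vector_field S X" "X (c t) = vector_derivative c (at t)"
    "w = (\<Sum>j<n. a' j *\<^sub>R E j (c t) + a j t *\<^sub>R levi_civita S (fisher_rao I) X (E j) (c t))"
    unfolding has_covariant_derivative_def by blast
  have ct: "c t \<in> S" using eventually_nhds_x_imp_x[OF c(1)] .
  have "eventually (\<lambda>s. U' s = (\<Sum>j<n. a j s *\<^sub>R pushforward S M (E j) (c' s))) (nhds t)"
    using *(3) c(1) c'(3) U'
    by eventually_elim
       (simp add: pushforward_vector_field[OF *(1)] M_S GM_S linear_sum[OF linear_M] linear_cmul[OF linear_M])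
  moreover have "pushforward S M X (c' t) = vector_derivative c' (at t)"
    using *(5) vector_derivative_at[OF c(2)] vector_derivative_at[OF c'(2)] ct
    by (simp add: c'(1) pushforward_vector_field[OF *(4)] M_S GM_S)
  moreover have "M w = (\<Sum>j<n. a' j *\<^sub>R pushforward S M (E j) (c' t) + a j t *\<^sub>R
      levi_civita T (fisher_rao J) (pushforward S M X) (pushforward S M (E j)) (c' t))"
    unfolding *(6) using ct
    by (simp add: c'(1) pushforward_vector_field[OF *(1)] levi_civita_pushforward[OF *(4) *(1)]
        M_S GM_S linear_sum[OF linear_M] linear_add[OF linear_M] linear_cmul[OF linear_M])
  ultimately show ?thesis
    unfolding has_covariant_derivative_def
    using *(1,2,4) smooth_vector_field_pushforward
    by (intro exI[of _ n] exI[of _ "\<lambda>j. pushforward S M (E j)"] exI[of _ a] exI[of _ a']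
        exI[of _ "pushforward S M X"]) simp
qed

text \<open>\<open>c'\<close> is any curve that agrees with the image on \<open>D\<close>. This
  freedom gives the converse by symmetry: applying \<open>G\<close> to \<open>M o c\<close> recovers
  \<open>c\<close> on \<open>D\<close>, but perhaps not elsewhere.\<close>

lemma geodesic_pushforward:
  assumes geo: "geodesic S (fisher_rao I) D c" and eq: "\<And>t. t \<in> D \<Longrightarrow> c' t = M (c t)"
  shows "geodesic T (fisher_rao J) D c'"
proof -
  have D: "open D" "is_interval D" "smooth_on D c" "c ` D \<subseteq> S"
    "\<And>t. t \<in> D \<Longrightarrow> has_covariant_derivative S (fisher_rao I) c (\<lambda>s. vector_derivative c (at s)) t 0"
    using geo unfolding geodesic_def by auto
  have "smooth_on D (\<lambda>t. M (c t))" by (rule smooth_on_linear_compose[OF bounded_linear_M D(3)])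
  then have sm: "smooth_on D c'" using smooth_on_cong[of D c' "\<lambda>t. M (c t)"] eq by blast
  have deriv: "(c' has_vector_derivative M (vector_derivative c (at t))) (at t)" if "t \<in> D" for t
  proof -
    have "((\<lambda>t. M (c t)) has_vector_derivative M (vector_derivative c (at t))) (at t)"
      using bounded_linear.has_vector_derivative[OF bounded_linear_M
          smooth_on_has_vector_derivative[OF D(3,1) that]] .
    then show ?thesis
      by (rule has_vector_derivative_transform_within_open[OF _ D(1) that]) (simp add: eq)
  qed
  have "has_covariant_derivative T (fisher_rao J) c' (\<lambda>s. vector_derivative c' (at s)) t 0" if t: "t \<in> D" for t
  proof -
    have near: "eventually (\<lambda>s. s \<in> D) (nhds t)" using D(1) t by (rule eventually_nhds_in_open)
    have "has_covariant_derivative T (fisher_rao J) c' (\<lambda>s. vector_derivative c' (at s)) t (M 0)"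
    proof (rule has_covariant_derivative_pushforward[OF D(5)[OF t] _
          smooth_on_has_vector_derivative[OF D(3,1) t] eq[OF t] deriv[OF t]])
      show "\<forall>\<^sub>F s in nhds t. c s \<in> S" using near by eventually_elim (use D(4) in auto)
      show "\<forall>\<^sub>F s in nhds t. c' s = M (c s)" using near by eventually_elim (rule eq)
      show "\<forall>\<^sub>F s in nhds t. vector_derivative c' (at s) = M (vector_derivative c (at s))"
        using near by eventually_elim (rule vector_derivative_at[OF deriv])
    qed
    then show ?thesis by (simp add: linear_0[OF linear_M])
  qed
  moreover have "c' ` D \<subseteq> T" using D(4) eq M_S by auto
  ultimately show ?thesis unfolding geodesic_def using D(1,2) sm by blast
qed

lemma geodesics: "preserves_geodesics S (fisher_rao I) T (fisher_rao J) M"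
proof -
  interpret swap: linear_fisher_isometry J T W I S V G M by (rule swap)
  have "geodesic S (fisher_rao I) D c \<longleftrightarrow> geodesic T (fisher_rao J) D (M \<circ> c)"
    if "c ` D \<subseteq> S" for D c
  proof
    show "geodesic T (fisher_rao J) D (M \<circ> c)" if "geodesic S (fisher_rao I) D c"
      by (rule geodesic_pushforward[OF that]) simp
    show "geodesic S (fisher_rao I) D c" if "geodesic T (fisher_rao J) D (M \<circ> c)"
      by (rule swap.geodesic_pushforward[OF that]) (use \<open>c ` D \<subseteq> S\<close> in \<open>auto simp: GM_S\<close>)
  qed
  then show ?thesis unfolding preserves_geodesics_def by blast
qed

end

section \<open>Volume\<close>

text \<open>The image is the preimage under the inverse \<open>g\<close> intersected with
  \<open>B\<close>, so only continuity of \<open>g\<close> matters.\<close>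

lemma openin_linear_image:
  assumes "openin (top_of_set A) U" "continuous_on UNIV g"
    and "f ` A \<subseteq> B" "g ` B \<subseteq> A" "\<And>x. x \<in> A \<Longrightarrow> g (f x) = x" "\<And>y. y \<in> B \<Longrightarrow> f (g y) = y"
  shows "openin (top_of_set B) (f ` U)"
proof -
  obtain O' where O': "open O'" "U = A \<inter> O'" using assms(1) by (auto simp: openin_open)
  have "f ` U = B \<inter> g -` O'"
  proof (intro equalityI subsetI)
    fix y assume "y \<in> B \<inter> g -` O'"
    then show "y \<in> f ` U" using assms(4,6) O' by (intro image_eqI[of _ _ "g y"]) auto
  qed (use assms(3,5) O' in auto)
  moreover have "open (g -` O')"
    using assms(2) O'(1) by (simp add: continuous_on_open_vimage)
  ultimately show ?thesis by (auto simp: openin_open)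
qed

context linear_fisher_isometry
begin

text \<open>Linear images of Borel sets need not be Borel, while preimages under \<open>G\<close>
  are. The preimage of \<open>B\<close> is cut down to the closed affine space M p + W, on which
  \<open>G\<close> is inverted by \<open>M\<close>.\<close>

lemma borel_image_M:
  assumes "B \<in> sets borel" "B \<subseteq> S"
  shows "M ` B \<in> sets borel"
proof (cases "B = {}")
  case False
  then obtain p where p: "p \<in> B" by blast
  have "M ` B = {q. q - M p \<in> W} \<inter> G -` B"
  proof (intro equalityI subsetI)
    fix q assume q: "q \<in> {q. q - M p \<in> W} \<inter> G -` B"
    then have "M (G (q - M p)) = q - M p" using MG_W by blast
    then have "M (G q) = q"
      using p assms(2) by (auto simp: linear_diff[OF linear_M] linear_diff[OF linear_G] GM_S)
    then show "q \<in> M ` B" using q by (intro image_eqI[of _ _ "G q"]) auto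
  next
    fix q assume "q \<in> M ` B"
    then show "q \<in> {q. q - M p \<in> W} \<inter> G -` B"
      using p assms(2) T.diff_mem M_S GM_S by (auto simp: subset_iff)
  qed
  moreover have "closed {q. q - M p \<in> W}"
  proof -
    have "{q. q - M p \<in> W} = (\<lambda>q. q - M p) -` W" by auto
    then show ?thesis
      using closed_subspace[OF T.subspace_V] by (auto intro!: closed_vimage continuous_intros)
  qed
  moreover have "G -` B \<in> sets borel"
    using measurable_sets[OF borel_measurable_continuous_onI[OF linear_continuous_on[OF bounded_linear_G]] assms(1)]
    by simp
  ultimately show ?thesis by (auto intro: borel_closed)
qed simp

text \<open>The parameter space of a chart lies in the ambient space of its manifold, so composing
  with \<open>M\<close> is not enough: parameters must also move to the other ambient space. A
  linear \<open>L\<close> sends the basis \<open>b\<close> to a basis \<open>b'\<close> there, and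
  the new chart is M o \<psi> o L'. Coordinates do not change, so the two volume integrands agree
  pointwise.\<close>

lemma transport_local_parametrization:
  assumes par: "local_parametrization k S b U \<psi>" and k: "k = dim W"
  shows "\<exists>b' U' \<psi>'. local_parametrization k T b' U' \<psi>' \<and> \<psi>' ` U' = M ` \<psi> ` U \<and>
    (\<forall>B. B \<subseteq> \<psi> ` U \<longrightarrow> parametrized_volume k (fisher_rao J) b' U' \<psi>' (M ` B)
      = parametrized_volume k (fisher_rao I) b U \<psi> B)"
proof -
  define A where "A = span (b ` {..<k})"
  have b: "inj_on b {..<k}" "independent (b ` {..<k})" and U: "openin (top_of_set A) U"
    and im: "openin (top_of_set S) (\<psi> ` U)" and diffeo: "diffeomorphism U (\<psi> ` U) \<psi>"
    using par unfolding local_parametrization_def A_def by auto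
  have inj\<psi>: "inj_on \<psi> U" and sm\<psi>: "smooth_on U \<psi>" and sminv: "smooth_on (\<psi> ` U) (inv_into U \<psi>)"
    using diffeo unfolding diffeomorphism_def by (auto simp: bij_betw_def)
  have imS: "\<psi> ` U \<subseteq> S" using openin_imp_subset[OF im] .
  have UA: "U \<subseteq> A" using openin_imp_subset[OF U] .
  interpret U: flat_piece U A
    by (rule flat_piece_openin[OF _ U]) (simp add: A_def)
  \<comment> \<open>\<open>W\<close> only supplies \<open>k\<close> independent vectors of the
    target's ambient space; this is where \<open>k = dim W\<close> enters.\<close>
  obtain B0 where B0: "B0 \<subseteq> W" "independent B0" "card B0 = dim W" using basis_exists[of W] by metis
  have "finite B0" using B0(2) independent_bound by blast
  then obtain b' where "bij_betw b' {0..<card B0} B0" using ex_bij_betw_nat_finite by blast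
  then have b': "inj_on b' {..<k}" "b' ` {..<k} = B0"
    using B0(3) k by (auto simp: bij_betw_def atLeast0LessThan)
  define A' where "A' = span (b' ` {..<k})"
  have ind': "independent (b' ` {..<k})" using B0(2) b'(2) by simp
  obtain L where L: "linear L" "\<forall>x\<in>b ` {..<k}. L x = (b' \<circ> inv_into {..<k} b) x"
    using linear_independent_extend[OF b(2)] by blast
  then have Lb: "L (b i) = b' i" if "i < k" for i using that b(1) by simp
  obtain L' where L': "linear L'" "\<forall>x\<in>b' ` {..<k}. L' x = (b \<circ> inv_into {..<k} b') x"
    using linear_independent_extend[OF ind'] by blast
  then have Lb': "L' (b' i) = b i" if "i < k" for i using that b'(1) by simp
  have L'L: "L' (L x) = x" if "x \<in> A" for x
  proof -
    have "(L' \<circ> L) y = y" if "y \<in> b ` {..<k}" for y using that by (auto simp: Lb Lb')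
    from linear_eq_on_span[OF linear_compose[OF L(1) L'(1)] linear_ident this] that
    show ?thesis by (simp add: A_def)
  qed
  have LL': "L (L' x) = x" if "x \<in> A'" for x
  proof -
    have "(L \<circ> L') y = y" if "y \<in> b' ` {..<k}" for y using that by (auto simp: Lb Lb')
    from linear_eq_on_span[OF linear_compose[OF L'(1) L(1)] linear_ident this] that
    show ?thesis by (simp add: A'_def)
  qed
  have "L ` A = span (L ` b ` {..<k})" unfolding A_def by (rule linear_span_image[OF L(1), symmetric])
  also have "L ` b ` {..<k} = b' ` {..<k}" by (auto simp: Lb image_iff)
  finally have LA: "L ` A = A'" unfolding A'_def .
  have LA': "L' ` A' = A" unfolding LA[symmetric] image_image using L'L by simp
  have bL: "bounded_linear L" and bL': "bounded_linear L'"
    using L(1) L'(1) linear_conv_bounded_linear by blast+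
  define U' where "U' = L ` U"
  define \<psi>' where "\<psi>' y = M (\<psi> (L' y))" for y
  have L'U': "L' ` U' = U" unfolding U'_def image_image using L'L UA by (force simp: subset_iff)
  have im': "\<psi>' ` U' = M ` \<psi> ` U"
    unfolding \<psi>'_def L'U'[symmetric] by (simp add: image_image)
  have opU': "openin (top_of_set A') U'"
    unfolding U'_def
    by (rule openin_linear_image[OF U linear_continuous_on[OF bL']]) (use LA LA' L'L LL' in auto)
  interpret U': flat_piece U' A'
    by (rule flat_piece_openin[OF _ opU']) (simp add: A'_def)
  have "openin (top_of_set T) (\<psi>' ` U')"
    unfolding im'
    by (rule openin_linear_image[OF im linear_continuous_on[OF bounded_linear_G]])
       (auto simp: M_S G_T GM_S MG_T)
  moreover have "diffeomorphism U' (\<psi>' ` U') \<psi>'"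
  proof -
    have inj: "inj_on \<psi>' U'"
    proof (rule inj_onI)
      fix x y assume xy: "x \<in> U'" "y \<in> U'" "\<psi>' x = \<psi>' y"
      then have mem: "L' x \<in> U" "L' y \<in> U" using L'U' by auto
      then have "\<psi> (L' x) = \<psi> (L' y)"
        using xy(3) inj_onD[OF inj_on_M] imS unfolding \<psi>'_def by blast
      then have "L' x = L' y" using inj_onD[OF inj\<psi>] mem by blast
      then show "x = y" using LL' xy U'_def LA UA by (metis (no_types, lifting) image_mono subsetD)
    qed
    have "smooth_on U' \<psi>'"
      unfolding \<psi>'_def
      by (intro smooth_on_linear_compose[OF bounded_linear_M]
          smooth_on_compose[OF smooth_on_linear[OF bL'] sm\<psi>]) (simp add: L'U')
    moreover have "smooth_on (\<psi>' ` U') (\<lambda>q. L (inv_into U \<psi> (G q)))"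
    proof (intro smooth_on_linear_compose[OF bL] smooth_on_compose[OF smooth_on_linear[OF bounded_linear_G] sminv])
      show "G ` \<psi>' ` U' \<subseteq> \<psi> ` U" unfolding im' using imS GM_S by auto
    qed
    moreover have "inv_into U' \<psi>' q = L (inv_into U \<psi> (G q))" if "q \<in> \<psi>' ` U'" for q
    proof -
      from that obtain y where y: "y \<in> U" "q = M (\<psi> y)" unfolding im' by blast
      then have "G q = \<psi> y" using imS GM_S by blast
      then have "inv_into U \<psi> (G q) = y" using inj\<psi> y(1) by simp
      moreover have "\<psi>' (L y) = q" "L y \<in> U'" using y L'L UA by (auto simp: \<psi>'_def U'_def)
      ultimately show ?thesis using inv_into_f_f[OF inj \<open>L y \<in> U'\<close>] by simp
    qed
    ultimately have "smooth_on (\<psi>' ` U') (inv_into U' \<psi>')"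
      using smooth_on_cong[of "\<psi>' ` U'" "inv_into U' \<psi>'" "\<lambda>q. L (inv_into U \<psi> (G q))"] by blast
    then show ?thesis
      unfolding diffeomorphism_def using inj \<open>smooth_on U' \<psi>'\<close> by (simp add: bij_betw_def)
  qed
  ultimately have par': "local_parametrization k T b' U' \<psi>'"
    unfolding local_parametrization_def using b'(1) ind' opU' A'_def by simp
  have vol: "parametrized_volume k (fisher_rao J) b' U' \<psi>' (M ` B)
      = parametrized_volume k (fisher_rao I) b U \<psi> B" if B: "B \<subseteq> \<psi> ` U" for B
  proof -
    have gram: "gram_det k (\<lambda>i j. fisher_rao J (\<psi>' (L y))
          (frechet_derivative \<psi>' (at (L y) within U') (b' i))
          (frechet_derivative \<psi>' (at (L y) within U') (b' j)))
      = gram_det k (\<lambda>i j. fisher_rao I (\<psi> y)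
          (frechet_derivative \<psi> (at y within U) (b i))
          (frechet_derivative \<psi> (at y within U) (b j)))" if y: "y \<in> U" for y
    proof -
      let ?D = "frechet_derivative \<psi> (at y within U)"
      have D: "(\<psi> has_derivative ?D) (at y within U)" by (rule U.smooth_on_has_derivative[OF sm\<psi> y])
      have Ly: "L y \<in> U'" "L' (L y) = y" using y UA L'L by (auto simp: U'_def)
      have "(\<psi> has_derivative ?D) (at (L' (L y)) within L' ` U')" using D by (simp add: L'U' Ly)
      from has_derivative_in_compose[OF bounded_linear_imp_has_derivative[OF bL'] this]
      have der: "(\<psi>' has_derivative (\<lambda>x. M (?D (L' x)))) (at (L y) within U')"
        unfolding \<psi>'_def[abs_def] by (rule bounded_linear.has_derivative[OF bounded_linear_M])
      have *: "frechet_derivative \<psi>' (at (L y) within U') (b' i) = M (?D (b i))" if "i < k" for i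
        using U'.frechet_derivative_eq[OF Ly(1) _ der, of "b' i"] that Lb'[OF that]
        by (simp add: A'_def span_base)
      \<comment> \<open>The isometry property is known on tangent vectors only, so the partial
        derivatives of the chart must be shown to lie in \<open>V\<close>.\<close>
      have DV: "?D (b i) \<in> V" if "i < k" for i
        by (rule U.frechet_derivative_mem[OF S.subspace_V y _ D])
           (use that imS y in \<open>auto simp: A_def span_base intro!: S.diff_mem\<close>)
      have "\<psi> y \<in> S" using imS y by blast
      then have "fisher_rao J (\<psi>' (L y))
          (frechet_derivative \<psi>' (at (L y) within U') (b' i))
          (frechet_derivative \<psi>' (at (L y) within U') (b' j))
        = fisher_rao I (\<psi> y) (?D (b i)) (?D (b j))" if "i < k" "j < k" for i j
        using that by (simp add: * DV M_metric \<psi>'_def Ly(2))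
      then show ?thesis
        unfolding gram_det_def
        by (intro sum.cong refl arg_cong2[of _ _ _ _ "(*)"] prod.cong) (auto dest: permutes_in_image)
    qed
    have "(\<Sum>i<k. x i *\<^sub>R b' i) = L (\<Sum>i<k. x i *\<^sub>R b i)" for x
      by (simp add: linear_sum[OF L(1)] linear_cmul[OF L(1)] Lb)
    moreover have "L y \<in> U' \<longleftrightarrow> y \<in> U" if "y \<in> A" for y
      using that L'L L'U' by (metis U'_def image_eqI)
    moreover have "(\<Sum>i<k. x i *\<^sub>R b i) \<in> A" for x
      unfolding A_def by (intro span_sum span_scale span_base) auto
    moreover have "\<psi>' (L y) \<in> M ` B \<longleftrightarrow> \<psi> y \<in> B" if "y \<in> U" for y
    proof -
      have "\<psi> y \<in> S" "B \<subseteq> S" "L' (L y) = y" using that imS B L'L UA by auto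
      then show ?thesis unfolding \<psi>'_def using inj_on_image_mem_iff[OF inj_on_M] by simp
    qed
    ultimately show ?thesis
      unfolding parametrized_volume_def Let_def
      by (intro nn_integral_cong) (simp add: gram cong: conj_cong if_cong)
  qed
  show ?thesis using par' im' vol by blast
qed

text \<open>Every finite family competing in the supremum on \<open>S\<close> is carried to one on
  \<open>T\<close> with the same total, so the sets of totals are nested. The opposite inequality
  comes from exchanging the two sides.\<close>

lemma riemannian_volume_le:
  assumes k: "k = dim W" and A: "A \<subseteq> S"
  shows "riemannian_volume k S (fisher_rao I) A \<le> riemannian_volume k T (fisher_rao J) (M ` A)"
  unfolding riemannian_volume_def
proof (rule Sup_subset_mono, rule subsetI)
  fix x assume "x \<in> {(\<Sum>i<n. parametrized_volume k (fisher_rao I) (b i) (W i) (\<psi> i) (B i)) | (n::nat) b W \<psi> B.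
            (\<forall>i<n. local_parametrization k S (b i) (W i) (\<psi> i) \<and>
                   B i \<in> sets borel \<and> B i \<subseteq> A \<inter> \<psi> i ` W i) \<and>
            disjoint_family_on B {..<n}}"
  then have "\<exists>(n::nat) b U \<psi> B. x = (\<Sum>i<n. parametrized_volume k (fisher_rao I) (b i) (U i) (\<psi> i) (B i)) \<and>
      (\<forall>i<n. local_parametrization k S (b i) (U i) (\<psi> i) \<and>
        B i \<in> sets borel \<and> B i \<subseteq> A \<inter> \<psi> i ` U i) \<and> disjoint_family_on B {..<n}"
    by (rule CollectD)
  then obtain n :: nat and b U \<psi> B where
    x: "x = (\<Sum>i<n. parametrized_volume k (fisher_rao I) (b i) (U i) (\<psi> i) (B i))"
    and pieces: "\<forall>i<n. local_parametrization k S (b i) (U i) (\<psi> i) \<and>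
      B i \<in> sets borel \<and> B i \<subseteq> A \<inter> \<psi> i ` U i"
    and disj: "disjoint_family_on B {..<n}"
    by (elim exE conjE) (rule that)
  have par: "\<And>i. i < n \<Longrightarrow> local_parametrization k S (b i) (U i) (\<psi> i)"
    and B: "\<And>i. i < n \<Longrightarrow> B i \<in> sets borel" "\<And>i. i < n \<Longrightarrow> B i \<subseteq> A \<inter> \<psi> i ` U i"
    using pieces by blast+
  \<comment> \<open>Bundling the requirements on a transported chart lets all charts be selected at
    once by the axiom of choice.\<close>
  define P where "P i b' U' \<psi>' \<longleftrightarrow> local_parametrization k T b' U' \<psi>' \<and> \<psi>' ` U' = M ` \<psi> i ` U i \<and>
      parametrized_volume k (fisher_rao J) b' U' \<psi>' (M ` B i)
        = parametrized_volume k (fisher_rao I) (b i) (U i) (\<psi> i) (B i)" for i b' U' \<psi>'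
  have "\<forall>i. \<exists>b' U' \<psi>'. i < n \<longrightarrow> P i b' U' \<psi>'"
    using transport_local_parametrization[OF par k] B(2) unfolding P_def by (meson le_infE)
  then obtain b' U' \<psi>' where P: "\<And>i. i < n \<Longrightarrow> P i (b' i) (U' i) (\<psi>' i)"
    unfolding choice_iff by blast
  then have *: "\<And>i. i < n \<Longrightarrow> local_parametrization k T (b' i) (U' i) (\<psi>' i)"
    "\<And>i. i < n \<Longrightarrow> \<psi>' i ` U' i = M ` \<psi> i ` U i"
    "\<And>i. i < n \<Longrightarrow> parametrized_volume k (fisher_rao J) (b' i) (U' i) (\<psi>' i) (M ` B i)
        = parametrized_volume k (fisher_rao I) (b i) (U i) (\<psi> i) (B i)"
    unfolding P_def by simp_all
  have "x = (\<Sum>i<n. parametrized_volume k (fisher_rao J) (b' i) (U' i) (\<psi>' i) (M ` B i))"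
    unfolding x using *(3) by (intro sum.cong) auto
  moreover have "M ` B i \<in> sets borel" "M ` B i \<subseteq> M ` A \<inter> \<psi>' i ` U' i" if "i < n" for i
    using B[OF that] A borel_image_M[of "B i"] *(2)[OF that] by auto
  moreover have "disjoint_family_on (\<lambda>i. M ` B i) {..<n}"
    unfolding disjoint_family_on_def
  proof (intro ballI impI)
    fix i j assume ij: "i \<in> {..<n}" "j \<in> {..<n}" "i \<noteq> j"
    have "M ` B i \<inter> M ` B j = M ` (B i \<inter> B j)"
      using inj_on_image_Int[OF inj_on_M, of "B i" "B j"] B(2) A ij by blast
    then show "M ` B i \<inter> M ` B j = {}" using disj ij by (simp add: disjoint_family_on_def)
  qed
  ultimately show "x \<in> {(\<Sum>i<n. parametrized_volume k (fisher_rao J) (b i) (W i) (\<psi> i) (B i)) | (n::nat) b W \<psi> B.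
            (\<forall>i<n. local_parametrization k T (b i) (W i) (\<psi> i) \<and>
                   B i \<in> sets borel \<and> B i \<subseteq> M ` A \<inter> \<psi> i ` W i) \<and>
            disjoint_family_on B {..<n}}"
    using *(1)
    by - (rule CollectI, rule exI[of _ n], rule exI[of _ b'], rule exI[of _ U'],
        rule exI[of _ \<psi>'], rule exI[of _ "\<lambda>i. M ` B i"], simp)
qed

lemma dim_eq: "dim V = dim W"
proof -
  have "M ` V = W" using M_V G_W MG_W by force
  moreover have "inj_on M (span V)"
    using S.subspace_V by (intro inj_on_inverseI[of _ G]) (simp add: span_eq_iff[THEN iffD2] GM_V)
  ultimately show ?thesis using dim_image_eq[OF linear_M, of V] by simp
qed

lemma volume: "preserves_volume (dim W) S (fisher_rao I) T (fisher_rao J) M"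
  unfolding preserves_volume_def
proof (intro allI impI antisym)
  fix A assume A: "A \<subseteq> S"
  show "riemannian_volume (dim W) S (fisher_rao I) A \<le> riemannian_volume (dim W) T (fisher_rao J) (M ` A)"
    by (rule riemannian_volume_le[OF refl A])
  interpret swap: linear_fisher_isometry J T W I S V G M by (rule swap)
  have "G ` M ` A = A" using A GM_S by (force simp: subset_iff)
  then show "riemannian_volume (dim W) T (fisher_rao J) (M ` A) \<le> riemannian_volume (dim W) S (fisher_rao I) A"
    using swap.riemannian_volume_le[OF dim_eq[symmetric], of "M ` A"] A M_S by auto
qed

end

section \<open>Simplices and the separatrix\<close>

lemma flat_piece_positive:
  fixes V :: "(real ^ 'i::finite) set"
  assumes "subspace V" "\<And>p q. p \<in> A \<Longrightarrow> q \<in> A \<Longrightarrow> q - p \<in> V" "\<And>p v. p \<in> A \<Longrightarrow> v \<in> V \<Longrightarrow> p + v \<in> A"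
  shows "flat_piece {p \<in> A. \<forall>i\<in>I. 0 < p $ i} V"
proof
  fix p assume p: "p \<in> {p \<in> A. \<forall>i\<in>I. 0 < p $ i}"
  \<comment> \<open>Coordinates are bounded by the norm, so any displacement shorter than the least
    coordinate preserves positivity; the 1 covers an empty \<open>I\<close>.\<close>
  define e where "e = Min (insert 1 ((\<lambda>i. p $ i) ` I))"
  have "p + v \<in> {p \<in> A. \<forall>i\<in>I. 0 < p $ i}" if v: "v \<in> V" "norm v < e" for v
  proof -
    have "0 < (p + v) $ i" if "i \<in> I" for i
    proof -
      have "\<bar>v $ i\<bar> < e" using component_le_norm_cart[of v i] v(2) by linarith
      moreover have "e \<le> p $ i" using that by (auto simp: e_def)
      ultimately show ?thesis by simp
    qed
    then show ?thesis using p v(1) assms(3) by auto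
  qed
  moreover have "e > 0" using p by (auto simp: e_def)
  ultimately show "\<exists>e>0. \<forall>v\<in>V. norm v < e \<longrightarrow> p + v \<in> {p \<in> A. \<forall>i\<in>I. 0 < p $ i}" by blast
qed (use assms in auto)

section \<open>The open simplex as a flat piece\<close>

definition simplex_direction :: "'i set \<Rightarrow> (real ^ 'i::finite) set" where
  "simplex_direction I = {h. (\<forall>i. i \<notin> I \<longrightarrow> h $ i = 0) \<and> (\<Sum>i\<in>I. h $ i) = 0}"

text \<open>Exhibits the simplex as an affine set cut out by strict inequalities, the shape required
  by \<open>flat_piece_positive\<close>.\<close>

lemma open_prob_simplex_eq:
  "open_prob_simplex I = {p \<in> {p. (\<forall>i. i \<notin> I \<longrightarrow> p $ i = 0) \<and> (\<Sum>i\<in>I. p $ i) = 1}. \<forall>i\<in>I. 0 < p $ i}"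
  unfolding open_prob_simplex_def prob_simplex_def by (auto intro: less_imp_le)

lemma open_prob_simplexD:
  assumes "p \<in> open_prob_simplex I"
  shows "i \<in> I \<Longrightarrow> 0 < p $ i" "i \<notin> I \<Longrightarrow> p $ i = 0" "(\<Sum>i\<in>I. p $ i) = 1"
  using assms unfolding open_prob_simplex_eq by auto

lemma subspace_simplex_direction: "subspace (simplex_direction I)"
  unfolding subspace_def simplex_direction_def by (auto simp: sum.distrib sum_distrib_left[symmetric])

text \<open>The coordinates of \<open>fisher_prod p u v\<close> add up to g(u, v), and those of
  \<open>p\<close> to 1, so subtracting g(u, v) p leaves coordinate sum 0.\<close>

lemma christoffel_simplex_direction:
  assumes "p \<in> open_prob_simplex I" "u \<in> simplex_direction I"
  shows "fisher_prod p u v - fisher_rao I p u v *\<^sub>R p \<in> simplex_direction I"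
proof -
  have "(\<Sum>i\<in>I. (fisher_prod p u v - fisher_rao I p u v *\<^sub>R p) $ i)
      = (\<Sum>i\<in>I. u $ i * v $ i / p $ i) - fisher_rao I p u v * (\<Sum>i\<in>I. p $ i)"
    by (simp add: fisher_prod_def sum_subtractf sum_distrib_left)
  also have "\<dots> = 0" using open_prob_simplexD(3)[OF assms(1)] by (simp add: fisher_rao_def)
  finally show ?thesis
    using assms open_prob_simplexD(2)[OF assms(1)] unfolding simplex_direction_def
    by (auto simp: fisher_prod_def)
qed

lemma fisher_piece_open_prob_simplex: "fisher_piece I (open_prob_simplex I) (simplex_direction I)"
proof -
  interpret flat_piece "open_prob_simplex I" "simplex_direction I"
    unfolding open_prob_simplex_eq
    by (rule flat_piece_positive[OF subspace_simplex_direction])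
       (auto simp: simplex_direction_def sum.distrib sum_subtractf)
  show ?thesis
    by unfold_locales
       (auto simp: open_prob_simplexD christoffel_simplex_direction, auto simp: simplex_direction_def)
qed

text \<open>A vertex of the simplex has coordinate sum 1; adjoining it to the sum-zero hyperplane
  spans the whole coordinate subspace of \<open>I\<close>, so the hyperplane has codimension
  one.\<close>

lemma dim_simplex_direction:
  assumes "I \<noteq> {}"
  shows "dim (simplex_direction I) = card I - 1"
proof -
  obtain k where k: "k \<in> I" using assms by blast
  define E where "E = {h :: real ^ 'a. \<forall>i. i \<notin> I \<longrightarrow> h $ i = 0}"
  define a where "a = (axis k 1 :: real ^ 'a)"
  have aE: "a \<in> E" using k by (auto simp: a_def E_def axis_def)
  have suma: "(\<Sum>i\<in>I. a $ i) = 1" using k by (simp add: a_def axis_def if_distrib cong: if_cong)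
  have na: "a \<notin> span (simplex_direction I)"
    unfolding span_eq_iff[THEN iffD2, OF subspace_simplex_direction] using suma
    by (simp add: simplex_direction_def)
  have subE: "subspace E" unfolding E_def subspace_def by auto
  have "E \<subseteq> span (insert a (simplex_direction I))"
  proof
    fix h assume h: "h \<in> E"
    have "h - (\<Sum>i\<in>I. h $ i) *\<^sub>R a \<in> simplex_direction I"
      using h aE suma by (simp add: simplex_direction_def E_def sum_subtractf sum_distrib_left[symmetric])
    then show "h \<in> span (insert a (simplex_direction I))"
      unfolding span_insert by (auto intro: span_base)
  qed
  moreover have "insert a (simplex_direction I) \<subseteq> E"
    using aE by (auto simp: simplex_direction_def E_def)
  ultimately have "span (insert a (simplex_direction I)) = E"
    using span_minimal[OF _ subE] by blast
  then have "dim E = dim (insert a (simplex_direction I))" by (metis dim_span)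
  also have "\<dots> = dim (simplex_direction I) + 1" using na by (simp add: dim_insert)
  moreover have "dim E = card I"
    unfolding E_def dim_vec_eq[symmetric] by (rule dim_substandard_cart)
  ultimately show ?thesis by simp
qed

text \<open>Numerator and denominator of \<open>C\<close> are combinations of the
  \<open>f \<nu>\<close> with coefficient vectors \<open>A *v p\<close> and
  \<open>A *v (p + \<rho> p)\<close>. Constancy is therefore proportionality of \<open>p\<close> and
  \<open>p + \<rho> p\<close>: independence of the \<open>f \<nu>\<close> compares coefficients and
  injectivity of \<open>A\<close> removes the matrix.\<close>

lemma separatrix_interior_eq:
  fixes C :: "real ^ 'z::finite \<Rightarrow> real \<Rightarrow> real" and A :: "real ^ 'z ^ 'n::finite"
  assumes sds: "spectral_duality_structure C f A B \<sigma> \<kappa>"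
  shows "separatrix_interior C =
    {p \<in> open_prob_simplex UNIV. \<forall>z. sqrt (\<kappa> z) * p $ z = sqrt (\<kappa> (\<sigma> z)) * p $ \<sigma> z}"
proof -
  note S = sds[unfolded spectral_duality_structure_def]
  have "\<forall>\<pi>\<in>prob_simplex UNIV. \<forall>\<gamma>\<in>{0<..<1}.
      0 < (\<Sum>z\<in>UNIV. \<pi> $ z * spectral_denominator f A B z \<gamma>) \<and>
      C \<pi> \<gamma> = (\<Sum>z\<in>UNIV. \<pi> $ z * spectral_numerator f A z \<gamma>) /
        (\<Sum>z\<in>UNIV. \<pi> $ z * spectral_denominator f A B z \<gamma>)"
    using S by (elim conjE)
  then have pos: "\<And>\<pi> \<gamma>. \<pi> \<in> prob_simplex UNIV \<Longrightarrow> \<gamma> \<in> {0<..<1} \<Longrightarrow>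
      0 < (\<Sum>z\<in>UNIV. \<pi> $ z * spectral_denominator f A B z \<gamma>)"
    and C: "\<And>\<pi> \<gamma>. \<pi> \<in> prob_simplex UNIV \<Longrightarrow> \<gamma> \<in> {0<..<1} \<Longrightarrow>
      C \<pi> \<gamma> = (\<Sum>z\<in>UNIV. \<pi> $ z * spectral_numerator f A z \<gamma>) /
        (\<Sum>z\<in>UNIV. \<pi> $ z * spectral_denominator f A B z \<gamma>)"
    by blast+
  have indep: "\<forall>a. (\<forall>\<gamma>\<in>{0<..<1}. (\<Sum>\<nu>\<in>UNIV. a \<nu> * f \<nu> \<gamma>) = 0) \<longrightarrow> (\<forall>\<nu>. a \<nu> = 0)"
    using S by (elim conjE)
  have rank: "rank A = CARD('z)" using S by (elim conjE)
  have \<sigma>: "\<sigma> (\<sigma> z) = z" and \<kappa>: "0 < \<kappa> z" and B: "B $ \<nu> $ z = \<kappa> z * A $ \<nu> $ \<sigma> z" for z \<nu>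
    using S by simp_all
  obtain K where K: "K > 0" "\<And>z. \<kappa> z * \<kappa> (\<sigma> z) = K" using S by auto
  have bij: "bij \<sigma>" using \<sigma> by (metis bij_betw_byWitness UNIV_I subsetI)
  have inj: "inj ((*v) A)" using full_rank_injective[of A] rank by simp
  \<comment> \<open>Reindexing along the involution moves the weights from \<open>B\<close> onto the
    vector: pairing \<open>p\<close> with a row of \<open>B\<close> equals pairing
    \<open>\<rho> p\<close> with the same row of \<open>A\<close>.\<close>
  define \<rho> where "\<rho> p = (\<chi> z. \<kappa> (\<sigma> z) * p $ \<sigma> z)" for p :: "real ^ 'z"
  have num: "(\<Sum>z\<in>UNIV. p $ z * spectral_numerator f A z \<gamma>) = (\<Sum>\<nu>\<in>UNIV. (A *v p) $ \<nu> * f \<nu> \<gamma>)" for p \<gamma>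
  proof -
    have "(\<Sum>z\<in>UNIV. p $ z * spectral_numerator f A z \<gamma>) = (\<Sum>z\<in>UNIV. \<Sum>\<nu>\<in>UNIV. A $ \<nu> $ z * p $ z * f \<nu> \<gamma>)"
      unfolding spectral_numerator_def by (simp add: sum_distrib_left mult_ac)
    also have "\<dots> = (\<Sum>\<nu>\<in>UNIV. \<Sum>z\<in>UNIV. A $ \<nu> $ z * p $ z * f \<nu> \<gamma>)" by (rule sum.swap)
    finally show ?thesis by (simp add: matrix_vector_mult_def sum_distrib_right)
  qed
  have den: "(\<Sum>z\<in>UNIV. p $ z * spectral_denominator f A B z \<gamma>)
      = (\<Sum>\<nu>\<in>UNIV. (A *v (p + \<rho> p)) $ \<nu> * f \<nu> \<gamma>)" for p \<gamma>
  proof -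
    have B': "(\<Sum>z\<in>UNIV. p $ z * B $ \<nu> $ z) = (A *v \<rho> p) $ \<nu>" for \<nu>
    proof -
      have "(A *v \<rho> p) $ \<nu> = (\<Sum>z\<in>UNIV. p $ \<sigma> z * B $ \<nu> $ \<sigma> z)"
        unfolding B by (simp add: matrix_vector_mult_def \<rho>_def \<sigma> mult_ac)
      also have "\<dots> = (\<Sum>z\<in>UNIV. p $ z * B $ \<nu> $ z)"
        by (rule sum.reindex_bij_betw[OF bij, of "\<lambda>z. p $ z * B $ \<nu> $ z"])
      finally show ?thesis by simp
    qed
    have "(\<Sum>z\<in>UNIV. p $ z * spectral_denominator f A B z \<gamma>)
      = (\<Sum>z\<in>UNIV. \<Sum>\<nu>\<in>UNIV. (A $ \<nu> $ z * p $ z + p $ z * B $ \<nu> $ z) * f \<nu> \<gamma>)"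
      unfolding spectral_denominator_def by (simp add: sum_distrib_left algebra_simps)
    also have "\<dots> = (\<Sum>\<nu>\<in>UNIV. \<Sum>z\<in>UNIV. (A $ \<nu> $ z * p $ z + p $ z * B $ \<nu> $ z) * f \<nu> \<gamma>)"
      by (rule sum.swap)
    also have "\<dots> = (\<Sum>\<nu>\<in>UNIV. ((A *v p) $ \<nu> + (A *v \<rho> p) $ \<nu>) * f \<nu> \<gamma>)"
      unfolding B'[symmetric] by (simp add: matrix_vector_mult_def sum_distrib_right sum.distrib distrib_right)
    finally show ?thesis by (simp add: matrix_vector_right_distrib)
  qed
  have "(\<lambda>\<gamma>. C p \<gamma>) constant_on {0<..<1} \<longleftrightarrow> (\<forall>z. sqrt (\<kappa> z) * p $ z = sqrt (\<kappa> (\<sigma> z)) * p $ \<sigma> z)"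
    if p: "p \<in> open_prob_simplex UNIV" for p
  proof
    have p': "p \<in> prob_simplex UNIV" using p by (simp add: open_prob_simplex_def)
    have p0: "0 < p $ z" for z using open_prob_simplexD(1)[OF p] by simp
    { assume "(\<lambda>\<gamma>. C p \<gamma>) constant_on {0<..<1}"
      then obtain c where c: "\<And>\<gamma>. \<gamma> \<in> {0<..<1} \<Longrightarrow> C p \<gamma> = c" unfolding constant_on_def by blast
      have "(\<Sum>\<nu>\<in>UNIV. (A *v (p - c *\<^sub>R (p + \<rho> p))) $ \<nu> * f \<nu> \<gamma>) = 0" if \<gamma>: "\<gamma> \<in> {0<..<1}" for \<gamma>
      proof -
        have "(\<Sum>\<nu>\<in>UNIV. (A *v p) $ \<nu> * f \<nu> \<gamma>) = c * (\<Sum>\<nu>\<in>UNIV. (A *v (p + \<rho> p)) $ \<nu> * f \<nu> \<gamma>)"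
          using C[OF p' \<gamma>] pos[OF p' \<gamma>] c[OF \<gamma>] unfolding num den by (simp add: field_simps)
        then show ?thesis
          by (simp add: matrix_vector_mult_diff_distrib matrix_vector_mult_scaleR
              sum_subtractf sum_distrib_left algebra_simps)
      qed
      then have "A *v (p - c *\<^sub>R (p + \<rho> p)) = 0"
        using indep[rule_format, of "\<lambda>\<nu>. (A *v (p - c *\<^sub>R (p + \<rho> p))) $ \<nu>"] by (simp add: vec_eq_iff)
      then have "p - c *\<^sub>R (p + \<rho> p) = 0"
        using injD[OF inj, of "p - c *\<^sub>R (p + \<rho> p)" 0] by simp
      then have eq: "p $ z = c * (p $ z + \<kappa> (\<sigma> z) * p $ \<sigma> z)" for z
        by (simp add: vec_eq_iff \<rho>_def)
      show "\<forall>z. sqrt (\<kappa> z) * p $ z = sqrt (\<kappa> (\<sigma> z)) * p $ \<sigma> z"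
      proof
        fix z
        \<comment> \<open>Solving p = c (p + \<rho> p) for the reflection gives \<rho> p = r p, with
          one ratio \<open>r\<close> for all sites.\<close>
        define r where "r = (1 - c) / c"
        have "c \<noteq> 0" using eq[of z] p0[of z] by auto
        then have r: "r * p $ z = \<kappa> (\<sigma> z) * p $ \<sigma> z" for z
          using eq[of z] by (simp add: r_def field_simps)
        have "0 < r * p $ z" unfolding r using \<kappa> p0 by simp
        then have "r \<noteq> 0" by auto
        \<comment> \<open>The ratio relation is used at \<open>\<sigma> z\<close> and then at
          \<open>z\<close>; the unknown \<open>r\<close> cancels and leaves an identity between
          squares, whose positive roots give the balance condition.\<close>
        have "r * (\<kappa> z * (p $ z)\<^sup>2) = (r * p $ z) * (\<kappa> z * p $ z)" by (simp add: power2_eq_square)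
        also have "\<kappa> z * p $ z = r * p $ \<sigma> z" using r[of "\<sigma> z"] by (simp add: \<sigma>)
        finally have "\<kappa> z * (p $ z)\<^sup>2 = \<kappa> (\<sigma> z) * (p $ \<sigma> z)\<^sup>2"
          using \<open>r \<noteq> 0\<close> unfolding r[of z] by (simp add: power2_eq_square)
        then have "sqrt (\<kappa> z * (p $ z)\<^sup>2) = sqrt (\<kappa> (\<sigma> z) * (p $ \<sigma> z)\<^sup>2)" by simp
        then show "sqrt (\<kappa> z) * p $ z = sqrt (\<kappa> (\<sigma> z)) * p $ \<sigma> z"
          using p0[of z] p0[of "\<sigma> z"] by (simp add: real_sqrt_mult)
      qed }
    { assume bal: "\<forall>z. sqrt (\<kappa> z) * p $ z = sqrt (\<kappa> (\<sigma> z)) * p $ \<sigma> z"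
      \<comment> \<open>Under balance the ratio on an orbit is the square root of \<kappa>(z)
        \<kappa>(\<sigma> z). Condition (S4) makes it the same on every orbit, so \<open>C\<close>
        has the constant value 1 / (1 + sqrt K).\<close>
      have "\<kappa> (\<sigma> z) * p $ \<sigma> z = sqrt K * p $ z" for z
      proof -
        have "\<kappa> (\<sigma> z) * p $ \<sigma> z = sqrt (\<kappa> (\<sigma> z)) * (sqrt (\<kappa> (\<sigma> z)) * p $ \<sigma> z)"
          using \<kappa>[of "\<sigma> z"] by (simp add: mult.assoc[symmetric])
        also have "\<dots> = sqrt K * p $ z"
          unfolding bal[rule_format, symmetric] K(2)[of z, symmetric] by (simp add: real_sqrt_mult)
        finally show ?thesis .
      qed
      then have "p + \<rho> p = (1 + sqrt K) *\<^sub>R p" by (simp add: vec_eq_iff \<rho>_def algebra_simps)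
      then have den': "(\<Sum>z\<in>UNIV. p $ z * spectral_denominator f A B z \<gamma>)
          = (1 + sqrt K) * (\<Sum>\<nu>\<in>UNIV. (A *v p) $ \<nu> * f \<nu> \<gamma>)" for \<gamma>
        unfolding den by (simp add: matrix_vector_mult_scaleR sum_distrib_left mult_ac)
      have "C p \<gamma> = 1 / (1 + sqrt K)" if \<gamma>: "\<gamma> \<in> {0<..<1}" for \<gamma>
        using pos[OF p' \<gamma>] unfolding C[OF p' \<gamma>] num den' by auto
      then show "(\<lambda>\<gamma>. C p \<gamma>) constant_on {0<..<1}" unfolding constant_on_def by blast }
  qed
  then show ?thesis
    unfolding separatrix_interior_def separatrix_def by (auto simp: open_prob_simplex_def)
qed

section \<open>Coarse-graining by a weighted involution\<close>

locale weighted_involution =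
  fixes \<sigma> :: "'z::finite \<Rightarrow> 'z" and \<kappa> :: "'z \<Rightarrow> real"
  assumes involution: "\<sigma> (\<sigma> z) = z" and \<kappa>_pos: "0 < \<kappa> z"
begin

text \<open>At a fixed point the set collapses to a singleton, so one formula covers pairs and
  neutral sites.\<close>

definition orbit :: "'z \<Rightarrow> 'z set" where
  "orbit z = {z, \<sigma> z}"

lemma coarse_sites_eq: "coarse_sites \<sigma> = range orbit"
proof (intro equalityI subsetI)
  fix Q assume "Q \<in> range orbit"
  then obtain z where "Q = orbit z" by blast
  then show "Q \<in> coarse_sites \<sigma>"
    by (cases "\<sigma> z = z") (auto simp: coarse_sites_def orbits_def neutral_sites_def orbit_def)
qed (auto simp: coarse_sites_def orbits_def neutral_sites_def orbit_def image_iff)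

lemma orbit_mem [simp]: "orbit z \<in> coarse_sites \<sigma>"
  by (simp add: coarse_sites_eq)

lemma orbit_\<sigma> [simp]: "orbit (\<sigma> z) = orbit z"
  by (auto simp: orbit_def involution)

lemma orbit_eq: "Q \<in> coarse_sites \<sigma> \<Longrightarrow> z \<in> Q \<Longrightarrow> orbit z = Q"
  unfolding coarse_sites_eq by (auto simp: orbit_def involution)

lemma card_coarse_sites: "card (coarse_sites \<sigma>) = card (orbits \<sigma>) + card (neutral_sites \<sigma>)"
proof -
  have "orbits \<sigma> \<inter> (\<lambda>z. {z}) ` neutral_sites \<sigma> = {}"
    by (auto simp: orbits_def neutral_sites_def doubleton_eq_iff)
  then show ?thesis
    unfolding coarse_sites_def by (subst card_Un_disjoint) (auto simp: card_image)
qed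

lemma sum_coarse_sites: "(\<Sum>Q\<in>coarse_sites \<sigma>. \<Sum>z\<in>Q. h z) = (\<Sum>z\<in>UNIV. h z)"
proof -
  have "{z \<in> UNIV. orbit z = Q} = Q" if "Q \<in> coarse_sites \<sigma>" for Q
    using that orbit_eq[OF that] by (auto simp: coarse_sites_eq orbit_def)
  moreover have "(\<Sum>Q\<in>coarse_sites \<sigma>. \<Sum>z\<in>{z \<in> UNIV. orbit z = Q}. h z) = (\<Sum>z\<in>UNIV. h z)"
    by (rule sum.group) auto
  ultimately show ?thesis by (simp cong: sum.cong)
qed

section \<open>Balanced vectors and their splitting over orbits\<close>

definition balanced :: "(real ^ 'z) set" where
  "balanced = {h. \<forall>z. sqrt (\<kappa> z) * h $ z = sqrt (\<kappa> (\<sigma> z)) * h $ \<sigma> z}"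

lemma subspace_balanced: "subspace balanced"
  unfolding subspace_def balanced_def by (auto simp: algebra_simps)

text \<open>Balance makes the mass at \<open>z\<close> inversely proportional to sqrt \<kappa>(z);
  within a pair this is the same as proportional to the root of the partner's weight. At a neutral
  site the share is 1.\<close>

definition share :: "'z \<Rightarrow> real" where
  "share z = sqrt (\<kappa> (\<sigma> z)) / (\<Sum>y\<in>orbit z. sqrt (\<kappa> y))"

lemma orbit_weight_pos: "0 < (\<Sum>y\<in>orbit z. sqrt (\<kappa> y))"
  using \<kappa>_pos by (intro sum_pos) (auto simp: orbit_def)

lemma share_pos: "0 < share z"
  unfolding share_def using \<kappa>_pos orbit_weight_pos by simp

lemma sum_orbit: "(\<Sum>y\<in>orbit z. h y) = (if \<sigma> z = z then h z else h z + h (\<sigma> z))"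
  by (auto simp: orbit_def)

lemma share_balanced: "sqrt (\<kappa> z) * share z = sqrt (\<kappa> (\<sigma> z)) * share (\<sigma> z)"
  by (simp add: share_def involution)

lemma sum_share: "(\<Sum>y\<in>orbit z. share y) = 1"
proof -
  have "(\<Sum>y\<in>orbit z. share y) = (\<Sum>y\<in>orbit z. sqrt (\<kappa> (\<sigma> y))) / (\<Sum>y\<in>orbit z. sqrt (\<kappa> y))"
    unfolding sum_divide_distrib using orbit_eq[OF orbit_mem[of z]]
    by (intro sum.cong) (auto simp: share_def)
  also have "(\<Sum>y\<in>orbit z. sqrt (\<kappa> (\<sigma> y))) = (\<Sum>y\<in>orbit z. sqrt (\<kappa> y))"
    by (simp add: sum_orbit involution)
  finally show ?thesis using orbit_weight_pos[of z] by simp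
qed

text \<open>Balance turns the partner's term
  \<open>sqrt (\<kappa> (\<sigma> z)) * h $ \<sigma> z\<close> into
  \<open>sqrt (\<kappa> z) * h $ z\<close>, so that \<open>h $ z\<close> factors out.\<close>

lemma share_mass:
  assumes "h \<in> balanced"
  shows "share z * (\<Sum>y\<in>orbit z. h $ y) = h $ z"
proof -
  have "sqrt (\<kappa> (\<sigma> z)) * (\<Sum>y\<in>orbit z. h $ y) = h $ z * (\<Sum>y\<in>orbit z. sqrt (\<kappa> y))"
    using assms by (simp add: balanced_def sum_orbit algebra_simps)
  then show ?thesis using orbit_weight_pos[of z] by (simp add: share_def field_simps)
qed

text \<open>A congruent Markov embedding in the sense of Chentsov: each coarse site distributes its
  mass over its members in fixed proportions.\<close>

definition spread :: "real ^ 'z set \<Rightarrow> real ^ 'z" where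
  "spread y = (\<chi> z. share z * y $ orbit z)"

lemma linear_spread: "linear spread"
  by (rule linearI) (simp_all add: spread_def vec_eq_iff algebra_simps)

lemma linear_coarse_mass: "linear (coarse_mass \<sigma>)"
  by (rule linearI) (simp_all add: coarse_mass_def vec_eq_iff sum.distrib sum_distrib_left)

lemma spread_balanced: "spread y \<in> balanced"
  using share_balanced by (simp add: balanced_def spread_def mult.assoc[symmetric])

lemma spread_coarse_mass: "h \<in> balanced \<Longrightarrow> spread (coarse_mass \<sigma> h) = h"
  by (simp add: vec_eq_iff spread_def coarse_mass_def share_mass)

text \<open>Coordinates are indexed by all sets of sites, and \<open>spread\<close> ignores those
  outside \<open>coarse_sites\<close>; vanishing there is what lets \<open>y\<close> be
  recovered.\<close>

lemma coarse_mass_spread: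
  assumes "\<And>Q. Q \<notin> coarse_sites \<sigma> \<Longrightarrow> y $ Q = 0"
  shows "coarse_mass \<sigma> (spread y) = y"
  unfolding vec_eq_iff
proof
  fix Q
  show "coarse_mass \<sigma> (spread y) $ Q = y $ Q"
  proof (cases "Q \<in> coarse_sites \<sigma>")
    case True
    have "(\<Sum>z\<in>Q. spread y $ z) = (\<Sum>z\<in>Q. share z) * y $ Q"
      unfolding sum_distrib_right by (intro sum.cong refl) (simp add: spread_def orbit_eq[OF True])
    moreover have "(\<Sum>z\<in>Q. share z) = 1" using True sum_share by (auto simp: coarse_sites_eq)
    ultimately show ?thesis using True by (simp add: coarse_mass_def)
  qed (simp add: coarse_mass_def assms)
qed

lemma sum_coarse_mass: "(\<Sum>Q\<in>coarse_sites \<sigma>. coarse_mass \<sigma> h $ Q) = (\<Sum>z\<in>UNIV. h $ z)"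
  by (simp add: coarse_mass_def sum_coarse_sites cong: sum.cong)

lemma sum_spread:
  assumes "\<And>Q. Q \<notin> coarse_sites \<sigma> \<Longrightarrow> y $ Q = 0"
  shows "(\<Sum>z\<in>UNIV. spread y $ z) = (\<Sum>Q\<in>coarse_sites \<sigma>. y $ Q)"
  using sum_coarse_mass[of "spread y"] coarse_mass_spread[OF assms] by simp

lemma fisher_prod_spread: "fisher_prod (spread p) (spread u) (spread v) = spread (fisher_prod p u v)"
  using share_pos by (simp add: vec_eq_iff fisher_prod_def spread_def less_imp_neq[symmetric])

lemma fisher_prod_balanced:
  assumes "p \<in> balanced" "u \<in> balanced" "v \<in> balanced"
  shows "fisher_prod p u v = spread (fisher_prod (coarse_mass \<sigma> p) (coarse_mass \<sigma> u) (coarse_mass \<sigma> v))"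
  using fisher_prod_spread[of "coarse_mass \<sigma> p" "coarse_mass \<sigma> u" "coarse_mass \<sigma> v"]
  by (simp add: spread_coarse_mass assms)

text \<open>Summing over an orbit does not commute with products in general. Here all vectors are
  spreads, and the product of spreads is the spread of the coarse product.\<close>

lemma coarse_mass_fisher_prod:
  assumes "p \<in> balanced" "u \<in> balanced" "v \<in> balanced"
  shows "coarse_mass \<sigma> (fisher_prod p u v)
    = fisher_prod (coarse_mass \<sigma> p) (coarse_mass \<sigma> u) (coarse_mass \<sigma> v)"
  unfolding fisher_prod_balanced[OF assms]
  by (rule coarse_mass_spread) (simp add: fisher_prod_def coarse_mass_def)

section \<open>The separatrix and the coarse simplex as isometric pieces\<close>

definition balanced_simplex :: "(real ^ 'z) set" where
  "balanced_simplex = {p \<in> open_prob_simplex UNIV. p \<in> balanced}"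

definition balanced_direction :: "(real ^ 'z) set" where
  "balanced_direction = balanced \<inter> simplex_direction UNIV"

sublocale fine: fisher_piece UNIV balanced_simplex balanced_direction
proof -
  have sub: "subspace balanced_direction"
    unfolding balanced_direction_def by (intro subspace_inter subspace_balanced subspace_simplex_direction)
  have eq: "balanced_simplex = {p \<in> {p \<in> balanced. (\<Sum>z\<in>UNIV. p $ z) = 1}. \<forall>z\<in>UNIV. 0 < p $ z}"
    unfolding balanced_simplex_def open_prob_simplex_eq by auto
  interpret flat_piece balanced_simplex balanced_direction
    unfolding eq
    by (rule flat_piece_positive[OF sub])
       (auto simp: balanced_direction_def simplex_direction_def sum.distrib sum_subtractf
         intro: subspace_add[OF subspace_balanced] subspace_diff[OF subspace_balanced])
  show "fisher_piece UNIV balanced_simplex balanced_direction"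
  proof
    fix p u v assume *: "p \<in> balanced_simplex" "u \<in> balanced_direction" "v \<in> balanced_direction"
    \<comment> \<open>Since the product is again a spread, it stays balanced; this is what makes the
      separatrix totally geodesic.\<close>
    then have "fisher_prod p u v \<in> balanced"
      by (simp add: balanced_simplex_def balanced_direction_def fisher_prod_balanced spread_balanced)
    then have "fisher_prod p u v - fisher_rao UNIV p u v *\<^sub>R p \<in> balanced"
      using * by (auto simp: balanced_simplex_def
          intro!: subspace_diff[OF subspace_balanced] subspace_scale[OF subspace_balanced])
    moreover have "fisher_prod p u v - fisher_rao UNIV p u v *\<^sub>R p \<in> simplex_direction UNIV"
      using * by (auto simp: balanced_simplex_def balanced_direction_def intro: christoffel_simplex_direction)
    ultimately show "fisher_prod p u v - fisher_rao UNIV p u v *\<^sub>R p \<in> balanced_direction"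
      by (simp add: balanced_direction_def)
  qed (auto simp: balanced_simplex_def balanced_direction_def simplex_direction_def open_prob_simplexD)
qed

sublocale coarse: fisher_piece "coarse_sites \<sigma>" "open_prob_simplex (coarse_sites \<sigma>)"
  "simplex_direction (coarse_sites \<sigma>)"
  by (rule fisher_piece_open_prob_simplex)

sublocale linear_fisher_isometry UNIV balanced_simplex balanced_direction
  "coarse_sites \<sigma>" "open_prob_simplex (coarse_sites \<sigma>)" "simplex_direction (coarse_sites \<sigma>)"
  "coarse_mass \<sigma>" spread
proof
  fix p assume p: "p \<in> balanced_simplex"
  show "spread (coarse_mass \<sigma> p) = p" using p by (simp add: balanced_simplex_def spread_coarse_mass)
  have "0 < coarse_mass \<sigma> p $ Q" if "Q \<in> coarse_sites \<sigma>" for Q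
    using that p by (auto simp: coarse_mass_def coarse_sites_eq orbit_def balanced_simplex_def
        open_prob_simplexD intro!: sum_pos)
  moreover have "(\<Sum>Q\<in>coarse_sites \<sigma>. coarse_mass \<sigma> p $ Q) = 1"
    using p by (simp add: sum_coarse_mass balanced_simplex_def open_prob_simplexD)
  ultimately show "coarse_mass \<sigma> p \<in> open_prob_simplex (coarse_sites \<sigma>)"
    by (simp add: open_prob_simplex_eq) (simp add: coarse_mass_def)
next
  fix q assume q: "q \<in> open_prob_simplex (coarse_sites \<sigma>)"
  show "coarse_mass \<sigma> (spread q) = q"
    by (rule coarse_mass_spread) (rule open_prob_simplexD(2)[OF q])
  have "(\<Sum>z\<in>UNIV. spread q $ z) = 1"
    using sum_spread[OF open_prob_simplexD(2)[OF q]] open_prob_simplexD(3)[OF q] by simp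
  moreover have "0 < spread q $ z" for z
    using share_pos open_prob_simplexD(1)[OF q] by (simp add: spread_def)
  ultimately show "spread q \<in> balanced_simplex"
    by (simp add: balanced_simplex_def open_prob_simplex_eq spread_balanced)
next
  fix v assume "v \<in> balanced_direction"
  then show "spread (coarse_mass \<sigma> v) = v" "coarse_mass \<sigma> v \<in> simplex_direction (coarse_sites \<sigma>)"
    by (simp_all add: balanced_direction_def simplex_direction_def spread_coarse_mass sum_coarse_mass)
       (simp add: coarse_mass_def)
next
  fix w assume w: "w \<in> simplex_direction (coarse_sites \<sigma>)"
  then show "coarse_mass \<sigma> (spread w) = w"
    by (intro coarse_mass_spread) (simp add: simplex_direction_def)
  show "spread w \<in> balanced_direction"
    using w sum_spread[of w] by (simp add: balanced_direction_def simplex_direction_def spread_balanced)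
next
  fix p u v assume *: "p \<in> balanced_simplex" "u \<in> balanced_direction" "v \<in> balanced_direction"
  then have "p \<in> balanced" "u \<in> balanced" "v \<in> balanced"
    by (auto simp: balanced_simplex_def balanced_direction_def)
  then show prod: "coarse_mass \<sigma> (fisher_prod p u v)
      = fisher_prod (coarse_mass \<sigma> p) (coarse_mass \<sigma> u) (coarse_mass \<sigma> v)"
    by (rule coarse_mass_fisher_prod)
  \<comment> \<open>The metric is the total mass of \<open>fisher_prod\<close>, and coarse-graining
    preserves total mass.\<close>
  have "fisher_rao (coarse_sites \<sigma>) (coarse_mass \<sigma> p) (coarse_mass \<sigma> u) (coarse_mass \<sigma> v)
      = (\<Sum>Q\<in>coarse_sites \<sigma>. coarse_mass \<sigma> (fisher_prod p u v) $ Q)"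
    unfolding prod by (simp add: fisher_rao_def fisher_prod_def)
  also have "\<dots> = fisher_rao UNIV p u v"
    unfolding sum_coarse_mass by (simp add: fisher_rao_def fisher_prod_def)
  finally show "fisher_rao (coarse_sites \<sigma>) (coarse_mass \<sigma> p) (coarse_mass \<sigma> u) (coarse_mass \<sigma> v)
      = fisher_rao UNIV p u v" .
qed (simp_all add: linear_add[OF linear_spread] linear_cmul[OF linear_spread] fisher_prod_spread
    linear_add[OF linear_coarse_mass] linear_cmul[OF linear_coarse_mass])

lemma dim_coarse: "dim (simplex_direction (coarse_sites \<sigma>)) = card (coarse_sites \<sigma>) - 1"
  by (rule dim_simplex_direction) (auto simp: coarse_sites_eq)

section \<open>The square-root map onto the sphere\<close>

lemma subspace_balance_subspace: "subspace (balance_subspace \<sigma> \<kappa>)"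
  unfolding subspace_def balance_subspace_def by (auto simp: algebra_simps)

text \<open>Links the two forms of balance: fourth roots of \<open>\<kappa>\<close> on the sphere
  become square roots on the simplex after squaring, which loses nothing for nonnegative
  coordinates.\<close>

lemma balance_iff_square:
  assumes "0 \<le> x" "0 \<le> y"
  shows "\<kappa> z powr (1/4) * x = \<kappa> z' powr (1/4) * y \<longleftrightarrow> sqrt (\<kappa> z) * x\<^sup>2 = sqrt (\<kappa> z') * y\<^sup>2"
proof -
  have sq: "(\<kappa> z powr (1/4))\<^sup>2 = sqrt (\<kappa> z)" for z
    using \<kappa>_pos[of z] by (simp add: powr_half_sqrt[symmetric] power2_eq_square powr_add[symmetric])
  have "\<kappa> z powr (1/4) * x = \<kappa> z' powr (1/4) * y
      \<longleftrightarrow> (\<kappa> z powr (1/4) * x)\<^sup>2 = (\<kappa> z' powr (1/4) * y)\<^sup>2"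
    using assms by (simp add: power2_eq_iff_nonneg)
  then show ?thesis by (simp add: power_mult_distrib sq)
qed

lemma sqrt_map_mem:
  assumes "p \<in> balanced_simplex"
  shows "sqrt_map p \<in> balance_subspace \<sigma> \<kappa> \<inter> sphere 0 2 \<inter> {x. \<forall>z. 0 < x $ z}"
proof -
  have p: "0 < p $ z" "(\<Sum>z\<in>UNIV. p $ z) = 1" for z
    using fine.pos[OF assms] assms by (simp_all add: balanced_simplex_def open_prob_simplexD(3))
  have "sqrt_map p \<bullet> sqrt_map p = 4 * (\<Sum>z\<in>UNIV. p $ z)"
    using p(1) by (simp add: inner_vec_def sqrt_map_def sum_distrib_left less_imp_le)
  then have "norm (sqrt_map p) = 2" by (simp add: norm_eq_sqrt_inner p(2))
  moreover have "sqrt_map p \<in> balance_subspace \<sigma> \<kappa>"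
    unfolding balance_subspace_def
  proof (intro CollectI allI impI)
    fix z
    show "\<kappa> z powr (1/4) * sqrt_map p $ z = \<kappa> (\<sigma> z) powr (1/4) * sqrt_map p $ \<sigma> z"
      using assms p(1)[of z] p(1)[of "\<sigma> z"]
      by (subst balance_iff_square)
         (simp_all add: sqrt_map_def power_mult_distrib balanced_simplex_def balanced_def less_imp_le)
  qed
  ultimately show ?thesis using p(1) by (simp add: sqrt_map_def)
qed

text \<open>Inverse of \<open>sqrt_map\<close> on positive vectors; the divisor 4 undoes its factor
  2.\<close>

definition square_map :: "real ^ 'z \<Rightarrow> real ^ 'z" where
  "square_map x = (\<chi> z. (x $ z)\<^sup>2 / 4)"

lemma square_map_mem:
  assumes "x \<in> balance_subspace \<sigma> \<kappa> \<inter> sphere 0 2 \<inter> {x. \<forall>z. 0 < x $ z}"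
  shows "square_map x \<in> balanced_simplex"
proof -
  have x: "0 < x $ z" for z using assms by simp
  have "x \<bullet> x = 4" using assms by (simp add: dot_square_norm)
  then have "(\<Sum>z\<in>UNIV. square_map x $ z) = 1"
    by (simp add: square_map_def inner_vec_def sum_divide_distrib[symmetric] power2_eq_square)
  moreover have "sqrt (\<kappa> z) * square_map x $ z = sqrt (\<kappa> (\<sigma> z)) * square_map x $ \<sigma> z" for z
  proof (cases "\<sigma> z = z")
    case False
    then have "\<kappa> z powr (1/4) * x $ z = \<kappa> (\<sigma> z) powr (1/4) * x $ \<sigma> z"
      using assms by (simp add: balance_subspace_def)
    then show ?thesis
      using balance_iff_square[of "x $ z" "x $ \<sigma> z" z "\<sigma> z"] x[of z] x[of "\<sigma> z"]
      by (simp add: square_map_def less_imp_le)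
  qed simp
  ultimately show ?thesis
    using x by (simp add: balanced_simplex_def open_prob_simplex_eq balanced_def)
      (simp add: square_map_def less_imp_neq[symmetric])
qed

lemma square_sqrt_map: "(\<And>z. 0 < p $ z) \<Longrightarrow> square_map (sqrt_map p) = p"
  by (simp add: vec_eq_iff square_map_def sqrt_map_def power_mult_distrib less_imp_le)

lemma sqrt_square_map: "(\<And>z. 0 < x $ z) \<Longrightarrow> sqrt_map (square_map x) = x"
  by (simp add: vec_eq_iff square_map_def sqrt_map_def real_sqrt_divide less_imp_le)

text \<open>The factor 2 cancels the 1/2 from differentiating the root, so the Euclidean product of
  two images is exactly the Fisher-Rao product.\<close>

lemma sqrt_map_has_derivative:
  assumes "\<And>z. 0 < p $ z"
  shows "(sqrt_map has_derivative (\<lambda>v. \<chi> z. v $ z / sqrt (p $ z))) (at (p :: real ^ 'z) within S)"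
proof -
  have "((\<lambda>x. 2 * sqrt (x $ z)) has_derivative (\<lambda>v. v $ z / sqrt (p $ z))) (at p within S)" for z
    using assms[of z]
    by (auto intro!: derivative_eq_intros bounded_linear.has_derivative[OF bounded_linear_vec_nth]
        simp: fun_eq_iff field_simps)
  then show ?thesis
    unfolding has_derivative_componentwise_within[of sqrt_map] sqrt_map_def
    by (auto simp: Basis_vec_def inner_axis)
qed

text \<open>\<open>riemannian_isometry\<close> tests tangent vectors of the source only, so the
  tangent spaces of the spherical target, which is not flat, need not be computed.\<close>

lemma sqrt_map_isometry:
  "riemannian_isometry balanced_simplex (fisher_rao UNIV)
    (balance_subspace \<sigma> \<kappa> \<inter> sphere 0 2 \<inter> {x. \<forall>z. 0 < x $ z}) (\<lambda>_. inner) sqrt_map"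
  (is "riemannian_isometry _ _ ?T _ _")
proof -
  have pos: "0 < p $ z" if "p \<in> balanced_simplex" for p z
    by (rule fine.pos[OF that UNIV_I])
  have bij: "bij_betw sqrt_map balanced_simplex ?T"
  proof (rule bij_betw_byWitness[of _ square_map])
    show "\<forall>p\<in>balanced_simplex. square_map (sqrt_map p) = p"
      using pos square_sqrt_map by blast
    show "\<forall>x\<in>?T. sqrt_map (square_map x) = x" by (simp add: sqrt_square_map)
    show "sqrt_map ` balanced_simplex \<subseteq> ?T" using sqrt_map_mem by blast
    show "square_map ` ?T \<subseteq> balanced_simplex" using square_map_mem by blast
  qed
  have "smooth_on balanced_simplex sqrt_map"
    unfolding sqrt_map_def[abs_def] using pos
    by (intro smooth_on_componentwise)
       (simp add: smooth_on_bilinear[OF bounded_bilinear_mult smooth_on_const smooth_on_sqrt]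
         smooth_on_linear[OF bounded_linear_vec_nth])
  moreover have "smooth_on ?T (inv_into balanced_simplex sqrt_map)"
  proof -
    have "smooth_on ?T square_map"
      unfolding square_map_def[abs_def] power2_eq_square divide_inverse
      by (intro smooth_on_componentwise, unfold vec_lambda_beta)
         (intro smooth_on_bilinear[OF bounded_bilinear_mult] smooth_on_const
           smooth_on_linear[OF bounded_linear_vec_nth])
    moreover have "inv_into balanced_simplex sqrt_map x = square_map x" if x: "x \<in> ?T" for x
      using inv_into_f_f[OF bij_betw_imp_inj_on[OF bij] square_map_mem[OF x]] x
      by (simp add: sqrt_square_map)
    ultimately show ?thesis using smooth_on_cong[of ?T "inv_into balanced_simplex sqrt_map" square_map] by blast
  qed
  moreover have "frechet_derivative sqrt_map (at p within balanced_simplex) v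
      \<bullet> frechet_derivative sqrt_map (at p within balanced_simplex) w = fisher_rao UNIV p v w"
    if p: "p \<in> balanced_simplex" and v: "v \<in> balanced_direction" and w: "w \<in> balanced_direction" for p v w
    unfolding fine.frechet_derivative_eq[OF p v sqrt_map_has_derivative[OF pos[OF p]]]
      fine.frechet_derivative_eq[OF p w sqrt_map_has_derivative[OF pos[OF p]]]
    using pos[OF p] by (simp add: inner_vec_def fisher_rao_def less_imp_le)
  ultimately show ?thesis
    unfolding riemannian_isometry_def diffeomorphism_def using bij by (simp add: fine.tangent_space_eq)
qed

end

theorem corollary5p7:
  fixes C :: "real ^ 'z::finite \<Rightarrow> real \<Rightarrow> real"
    and f :: "'n::finite \<Rightarrow> real \<Rightarrow> real"
    and A B :: "real ^ 'z ^ 'n"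
    and \<sigma> :: "'z \<Rightarrow> 'z"
    and \<kappa> :: "'z \<Rightarrow> real"
    and n_pair n_0 d :: nat
  assumes "2 \<le> CARD('z)"
    and "spectral_duality_structure C f A B \<sigma> \<kappa>"
    and "n_pair = card (orbits \<sigma>)"
    and "n_0 = card (neutral_sites \<sigma>)"
    and "d = n_pair + n_0"
  shows
    "card (coarse_sites \<sigma>) = d \<and>
     riemannian_manifold (d - 1) (separatrix_interior C) (fisher_rao UNIV) \<and>
     riemannian_manifold (d - 1) (open_prob_simplex (coarse_sites \<sigma>)) (fisher_rao (coarse_sites \<sigma>)) \<and>
     riemannian_isometry
       (separatrix_interior C) (fisher_rao UNIV)
       (open_prob_simplex (coarse_sites \<sigma>)) (fisher_rao (coarse_sites \<sigma>))
       (coarse_mass \<sigma>) \<and>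
     subspace (balance_subspace \<sigma> \<kappa>) \<and>
     riemannian_isometry
       (separatrix_interior C) (fisher_rao UNIV)
       (balance_subspace \<sigma> \<kappa> \<inter> sphere 0 2 \<inter> {x. \<forall>z. 0 < x $ z}) (\<lambda>_. inner)
       sqrt_map \<and>
     preserves_connection
       (separatrix_interior C) (fisher_rao UNIV)
       (open_prob_simplex (coarse_sites \<sigma>)) (fisher_rao (coarse_sites \<sigma>))
       (coarse_mass \<sigma>) \<and>
     preserves_curvature
       (separatrix_interior C) (fisher_rao UNIV)
       (open_prob_simplex (coarse_sites \<sigma>)) (fisher_rao (coarse_sites \<sigma>))
       (coarse_mass \<sigma>) \<and>
     preserves_geodesics
       (separatrix_interior C) (fisher_rao UNIV)
       (open_prob_simplex (coarse_sites \<sigma>)) (fisher_rao (coarse_sites \<sigma>))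
       (coarse_mass \<sigma>) \<and>
     preserves_volume (d - 1)
       (separatrix_interior C) (fisher_rao UNIV)
       (open_prob_simplex (coarse_sites \<sigma>)) (fisher_rao (coarse_sites \<sigma>))
       (coarse_mass \<sigma>) \<and>
     (\<forall>(\<iota> :: (real ^ 'z) set \<Rightarrow> (real ^ 'z) metric_tensor \<Rightarrow> 'v)
        (\<iota>' :: (real ^ 'z set) set \<Rightarrow> (real ^ 'z set) metric_tensor \<Rightarrow> 'v).
        intrinsic_invariant \<iota> \<iota>' \<longrightarrow>
        \<iota> (separatrix_interior C) (fisher_rao UNIV) =
        \<iota>' (open_prob_simplex (coarse_sites \<sigma>)) (fisher_rao (coarse_sites \<sigma>)))"
proof -
  have \<sigma>: "\<sigma> (\<sigma> z) = z" and \<kappa>: "0 < \<kappa> z" for z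
    using assms(2) unfolding spectral_duality_structure_def by simp_all
  interpret weighted_involution \<sigma> \<kappa> by unfold_locales (rule \<sigma>, rule \<kappa>)
  have S: "separatrix_interior C = balanced_simplex"
    unfolding separatrix_interior_eq[OF assms(2)] balanced_simplex_def balanced_def by simp
  have card: "card (coarse_sites \<sigma>) = d"
    unfolding card_coarse_sites using assms by simp
  \<comment> \<open>The dimension of the separatrix is read off the coarse simplex, to which its
    direction space is linearly isomorphic.\<close>
  have dims: "dim (simplex_direction (coarse_sites \<sigma>)) = d - 1" "dim balanced_direction = d - 1"
    unfolding dim_eq using dim_coarse card by simp_all
  note fine = fine.riemannian_manifold[unfolded dims]
  note coarse = coarse.riemannian_manifold[unfolded dims]
  \<comment> \<open>\<open>intrinsic_invariant\<close> asks for manifolds of one common dimension,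
    which is why both were given dimension \<open>d - 1\<close> beforehand.\<close>
  have "\<iota> balanced_simplex (fisher_rao UNIV) = \<iota>' (open_prob_simplex (coarse_sites \<sigma>)) (fisher_rao (coarse_sites \<sigma>))"
    if "intrinsic_invariant \<iota> \<iota>'"
    for \<iota> :: "(real ^ 'z) set \<Rightarrow> (real ^ 'z) metric_tensor \<Rightarrow> 'v"
      and \<iota>' :: "(real ^ 'z set) set \<Rightarrow> (real ^ 'z set) metric_tensor \<Rightarrow> 'v"
    using that fine coarse isometry unfolding intrinsic_invariant_def by blast
  then show ?thesis
    unfolding S
    by (intro conjI allI impI card fine coarse isometry subspace_balance_subspace sqrt_map_isometry
        connection curvature geodesics volume[unfolded dims])
qed

end
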